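(* Let $n\ge2$, $\bar p\in\mathbb{E}^n_\nu$, and let $T_{\bar p}\mathbb{E}^n_\nu=V_0\oplus V_1\oplus\cdots\oplus V_k$ be an orthogonal decomposition into non-trivial (hence non-degenerate) subspaces with $k\ge1$. Suppose $a_1,\dots,a_k\in V_0$ are pairwise orthogonal; put $\kappa_i:=a_i^2$ and $\epsilon_i:=\operatorname{sgn}\kappa_i$. Assume one of the following two cases. Non-null case: for some $\mu\ge0$, $\kappa_1\le\cdots\le\kappa_\mu<0<\kappa_{\mu+1}\le\cdots\le\kappa_k$. In this case let $c:=\bar p-\sum_{i=1}^k\frac{a_i}{\kappa_i}$. Null case: $k=1$ and $a:=a_1$ is lightlike ($a\ne0$, $a^2=0$). In this case fix a lightlike vector $b\in V_0$ with $\langle a,b\rangle=1$ and let $c:=\bar p-b$. Define $N_0:=c+\{p\in V_0:\langle a_i,p\rangle>0\text{ for all }i\}$ (an open subset of the plane $\bar p+V_0$), for $i=1,\dots,k$ let $N_i$ be the spherical submanifold of $\mathbb{E}^n_\nu$ determined by $(\bar p,V_i,a_i)$, and let $\rho_i:N_0\to\mathbb{R}_+$, $\rho_i(p_0)=\langle a_i,p_0-c\rangle=1+\langle a_i,p_0-\bar p\rangle$. For $i=1,\dots,k$ let $W_i:=\mathbb{R}a_i\oplus V_i$ and, in the non-null case, let $P_i:\mathbb{E}^n_\nu\to W_i$ be the orthogonal projection. Then the map $$\psi:N_0\times_{\rho_1}N_1\times\cdots\times_{\rho_k}N_k\to\mathbb{E}^n_\nu,\qquad \psi(p_0,\dots,p_k)=p_0+\sum_{i=1}^k\rho_i(p_0)(p_i-\bar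 p)$$ is an isometry onto the set $$c+\{p\in\mathbb{E}^n_\nu:\operatorname{sgn}(P_i(p))^2=\epsilon_i\text{ for each }i=1,\dots,k\}\quad\text{(non-null case)},$$ $$c+\{p\in\mathbb{E}^n_\nu:\langle a,p\rangle>0\}\quad\text{(null case)}.$$ The image of $\psi$ is dense in $\mathbb{E}^n_\nu$ only in the non-null case when each $W_i$, $i=1,\dots,k$, is Euclidean or anti-isometric to a Euclidean space (i.e. positive or negative definite).
   Context: $\mathbb{E}^n_\nu$ denotes pseudo-Euclidean space: an $n$-dimensional real vector space with a non-degenerate symmetric bilinear form $\langle\cdot,\cdot\rangle$ having $\nu$ negative diagonal entries in a diagonalizing basis; $x^2:=\langle x,x\rangle$; $x\ne0$ is lightlike if $x^2=0$. Tangent vectors are identified with vectors of $\mathbb{E}^n_\nu$. $\operatorname{sgn}0=0$. The spherical submanifold $N$ of $\mathbb{E}^n_\nu$ determined by $(\bar p,V,a)$, where $V$ is a non-degenerate subspace and $a\in V^\perp$, $a\neq 0$, is the following subset with the induced metric. If $\tilde\kappa:=a^2\ne0$: $N=(\bar p-\frac{a}{\tilde\kappa})+\{p\in\mathbb{R}a\oplus V:p^2=1/\tilde\kappa\}$. If $a$ is lightlike: $N=\bar p+\{p-\frac12p^2a:p\in V\}$. (It passes through $\bar p$ with tangent space $V$ and mean curvature vector $-a$ at $\bar p$.) The warped product $N_0\times_{\rho_1}N_1\times\cdots\times_{\rho_k}N_k$ of pseudo-Riemannian manifolds $(N_i,g_i)$ with functions $\rho_i:N_0\to\mathbb{R}^+$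 is the product manifold with metric $\pi_0^*g_0+\sum_{i=1}^k\rho_i^2\,\pi_i^*g_i$, $\pi_i$ being the canonical projections. *)

theory Defs
  imports "HOL-Analysis.Analysis"
begin

text \<open>
  A bilinear form \<open>B\<close> on the ambient space is restricted to the subspace \<open>V\<close>; its index \<open>\<nu>\<close> is the
  number of negative diagonal entries in a diagonalizing basis \<open>E\<close> of \<open>V\<close>.
\<close>

definition scalar_product_on ::
    "'e::euclidean_space set \<Rightarrow> ('e \<Rightarrow> 'e \<Rightarrow> real) \<Rightarrow> nat \<Rightarrow> bool" where
  "scalar_product_on V B \<nu> \<longleftrightarrow>
     subspace V \<and> bilinear B \<and> (\<forall>x y. B x y = B y x) \<and>
     (\<forall>x\<in>V. (\<forall>y\<in>V. B x y = 0) \<longrightarrow> x = 0) \<and>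
     (\<exists>E. independent E \<and> span E = V \<and> (\<forall>x\<in>E. \<forall>y\<in>E. x \<noteq> y \<longrightarrow> B x y = 0) \<and>
          card {x\<in>E. B x x < 0} = \<nu>)"

text \<open>
  The type \<open>'a\<close> equipped with \<open>B\<close> is the pseudo-Euclidean space of dimension \<open>DIM('a)\<close> and index \<open>\<nu>\<close>.
  The inner product of the type class only provides the (canonical) topology and smooth structure of
  the underlying finite-dimensional vector space.
\<close>

definition pseudo_euclidean :: "('a::euclidean_space \<Rightarrow> 'a \<Rightarrow> real) \<Rightarrow> nat \<Rightarrow> bool" where
  "pseudo_euclidean B \<nu> \<longleftrightarrow> scalar_product_on UNIV B \<nu>"

definition lightlike :: "('a::euclidean_space \<Rightarrow> 'a \<Rightarrow> real) \<Rightarrow> 'a \<Rightarrow> bool" where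
  "lightlike B x \<longleftrightarrow> x \<noteq> 0 \<and> B x x = 0"

definition definite_on :: "'a::euclidean_space set \<Rightarrow> ('a \<Rightarrow> 'a \<Rightarrow> real) \<Rightarrow> bool" where
  "definite_on W B \<longleftrightarrow>
     (\<forall>x\<in>W. x \<noteq> 0 \<longrightarrow> B x x > 0) \<or> (\<forall>x\<in>W. x \<noteq> 0 \<longrightarrow> B x x < 0)"

text \<open>Meaningful when \<open>B\<close> is non-degenerate on the subspace \<open>W\<close>, which makes the vector unique.\<close>

definition orth_proj :: "('a::euclidean_space \<Rightarrow> 'a \<Rightarrow> real) \<Rightarrow> 'a set \<Rightarrow> 'a \<Rightarrow> 'a" where
  "orth_proj B W x = (THE y. y \<in> W \<and> (\<forall>w\<in>W. B (x - y) w = 0))"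


text \<open>
  In finite dimensions a map is \<open>C\<^sup>n\<^sup>+\<^sup>1\<close> on an open set iff it is differentiable there and all its
  directional derivatives are \<open>C\<^sup>n\<close>.
\<close>

primrec Ck_on ::
    "nat \<Rightarrow> ('a::euclidean_space \<Rightarrow> 'b::euclidean_space) \<Rightarrow> 'a set \<Rightarrow> bool" where
  "Ck_on 0 f U = continuous_on U f"
| "Ck_on (Suc n) f U =
     ((\<forall>x\<in>U. f differentiable (at x)) \<and>
      (\<forall>v. Ck_on n (\<lambda>x. frechet_derivative f (at x) v) U))"

text \<open>On a set that need not be open, smooth means locally extendable to a \<open>C\<^sup>\<infinity>\<close> map.\<close>

definition smooth_on ::
    "'a::euclidean_space set \<Rightarrow> ('a \<Rightarrow> 'b::euclidean_space) \<Rightarrow> bool" where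
  "smooth_on S f \<longleftrightarrow>
     (\<forall>x\<in>S. \<exists>U F. open U \<and> x \<in> U \<and> (\<forall>n. Ck_on n F U) \<and> (\<forall>y\<in>S \<inter> U. F y = f y))"

definition diffeomorphism_onto ::
    "'a::euclidean_space set \<Rightarrow> 'b::euclidean_space set \<Rightarrow> ('a \<Rightarrow> 'b) \<Rightarrow> bool" where
  "diffeomorphism_onto M N f \<longleftrightarrow>
     bij_betw f M N \<and> smooth_on M f \<and> smooth_on N (inv_into M f)"

text \<open>
  Every point has a neighbourhood in \<open>M\<close> diffeomorphic to an open subset of an \<open>m\<close>-dimensional vector
  space. As \<open>m\<close> never exceeds the ambient dimension, that vector space can be taken inside the
  ambient one.
\<close>

definition submanifold :: "nat \<Rightarrow> 'e::euclidean_space set \<Rightarrow> bool" where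
  "submanifold m M \<longleftrightarrow>
     (\<forall>x\<in>M. \<exists>U L \<Omega> \<phi>. open U \<and> x \<in> U \<and> subspace L \<and> dim L = m \<and>
        openin (top_of_set L) \<Omega> \<and> diffeomorphism_onto (M \<inter> U) (\<Omega> :: 'e set) \<phi>)"

definition tangent_space :: "'e::euclidean_space set \<Rightarrow> 'e \<Rightarrow> 'e set" where
  "tangent_space M x =
     {v. \<exists>\<gamma> \<epsilon>. \<epsilon> > 0 \<and> smooth_on {-\<epsilon><..<\<epsilon>} \<gamma> \<and> \<gamma> ` {-\<epsilon><..<\<epsilon>} \<subseteq> M \<and>
            \<gamma> (0::real) = x \<and> (\<gamma> has_vector_derivative v) (at 0)}"

text \<open>
  A metric tensor on \<open>M\<close> is given by a smooth family of symmetric bilinear forms on the ambient space,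
  only the restrictions \<open>g x\<close> to \<open>tangent_space M x\<close> being relevant.
\<close>

definition pseudo_riemannian ::
    "nat \<Rightarrow> nat \<Rightarrow> 'e::euclidean_space set \<Rightarrow> ('e \<Rightarrow> 'e \<Rightarrow> 'e \<Rightarrow> real) \<Rightarrow> bool" where
  "pseudo_riemannian m \<nu> M g \<longleftrightarrow>
     submanifold m M \<and> (\<forall>x\<in>M. scalar_product_on (tangent_space M x) (g x) \<nu>) \<and>
     (\<forall>u v. smooth_on M (\<lambda>x. g x u v))"

text \<open>
  The derivative \<open>D\<close> within \<open>M\<close> is unique on the tangent space, where it is the differential of \<open>f\<close>;
  the last conjunct says that \<open>f\<close> pulls \<open>h\<close> back to \<open>g\<close>.
\<close>

definition isometry_onto ::
    "'d::euclidean_space set \<Rightarrow> ('d \<Rightarrow> 'd \<Rightarrow> 'd \<Rightarrow> real) \<Rightarrow>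
     'e::euclidean_space set \<Rightarrow> ('e \<Rightarrow> 'e \<Rightarrow> 'e \<Rightarrow> real) \<Rightarrow> ('d \<Rightarrow> 'e) \<Rightarrow> bool" where
  "isometry_onto M g N h f \<longleftrightarrow>
     (\<exists>m \<nu>. pseudo_riemannian m \<nu> M g) \<and> (\<exists>m \<nu>. pseudo_riemannian m \<nu> N h) \<and>
     diffeomorphism_onto M N f \<and>
     (\<forall>x\<in>M. \<exists>D. (f has_derivative D) (at x within M) \<and>
        (\<forall>u\<in>tangent_space M x. \<forall>v\<in>tangent_space M x. h (f x) (D u) (D v) = g x u v))"


text \<open>
  The index set \<open>{1,\<dots>,k}\<close> is a finite linearly ordered type \<open>'k\<close> (so \<open>k = CARD('k) \<ge> 1\<close>).
  A point of the product is a pair consisting of its component in the base and the vector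
  of its other components.
\<close>

definition warped_carrier ::
    "'a::euclidean_space set \<Rightarrow> ('k::finite \<Rightarrow> 'a set) \<Rightarrow> ('a \<times> ('a ^ 'k)) set" where
  "warped_carrier N0 N = {z. fst z \<in> N0 \<and> (\<forall>i. snd z $ i \<in> N i)}"

definition warped_metric ::
    "('a::euclidean_space \<Rightarrow> 'a \<Rightarrow> 'a \<Rightarrow> real) \<Rightarrow> ('k::finite \<Rightarrow> 'a \<Rightarrow> 'a \<Rightarrow> 'a \<Rightarrow> real) \<Rightarrow>
     ('k \<Rightarrow> 'a \<Rightarrow> real) \<Rightarrow> 'a \<times> ('a ^ 'k) \<Rightarrow> 'a \<times> ('a ^ 'k) \<Rightarrow> 'a \<times> ('a ^ 'k) \<Rightarrow> real" where
  "warped_metric g0 g \<rho> z u v =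
     g0 (fst z) (fst u) (fst v) +
     (\<Sum>i\<in>UNIV. (\<rho> i (fst z))\<^sup>2 * g i (snd z $ i) (snd u $ i) (snd v $ i))"


definition line_plus :: "'a::euclidean_space \<Rightarrow> 'a set \<Rightarrow> 'a set" where
  "line_plus a V = {t *\<^sub>R a + v | t v. v \<in> V}"

text \<open>Used for \<open>a \<noteq> 0\<close> orthogonal to \<open>V\<close>, so that the second case is that of a lightlike \<open>a\<close>.\<close>

definition spherical ::
    "('a::euclidean_space \<Rightarrow> 'a \<Rightarrow> real) \<Rightarrow> 'a \<Rightarrow> 'a set \<Rightarrow> 'a \<Rightarrow> 'a set" where
  "spherical B pbar V a =
     (if B a a \<noteq> 0
      then {pbar - (1 / B a a) *\<^sub>R a + p | p. p \<in> line_plus a V \<and> B p p = 1 / B a a}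
      else {pbar + (p - (B p p / 2) *\<^sub>R a) | p. p \<in> V})"

definition orthogonal_decomposition ::
    "('a::euclidean_space \<Rightarrow> 'a \<Rightarrow> real) \<Rightarrow> 'a set \<Rightarrow> ('k::finite \<Rightarrow> 'a set) \<Rightarrow> bool" where
  "orthogonal_decomposition B V0 V \<longleftrightarrow>
     subspace V0 \<and> (\<forall>i. subspace (V i)) \<and>
     (\<forall>x\<in>V0. \<forall>i. \<forall>y\<in>V i. B x y = 0) \<and>
     (\<forall>i j. i \<noteq> j \<longrightarrow> (\<forall>x\<in>V i. \<forall>y\<in>V j. B x y = 0)) \<and>
     (\<forall>x. \<exists>!w :: 'a \<times> ('a ^ 'k). fst w \<in> V0 \<and> (\<forall>i. snd w $ i \<in> V i) \<and>
            x = fst w + (\<Sum>i\<in>UNIV. snd w $ i))"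

text \<open>
  \<open>\<kappa>\<^sub>1 \<le> \<dots> \<le> \<kappa>\<^sub>\<mu> < 0 < \<kappa>\<^sub>\<mu>\<^sub>+\<^sub>1 \<le> \<dots> \<le> \<kappa>\<^sub>k\<close>, where \<open>card {..i}\<close> is the position of the index \<open>i\<close>.
\<close>

definition nonnull_case ::
    "('a::euclidean_space \<Rightarrow> 'a \<Rightarrow> real) \<Rightarrow> ('k::{finite,linorder} \<Rightarrow> 'a) \<Rightarrow> bool" where
  "nonnull_case B a \<longleftrightarrow>
     (\<exists>\<mu>. \<mu> \<le> CARD('k) \<and>
        (\<forall>i j. i \<le> j \<longrightarrow> B (a i) (a i) \<le> B (a j) (a j)) \<and>
        (\<forall>i. card {..i} \<le> \<mu> \<longrightarrow> B (a i) (a i) < 0) \<and>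
        (\<forall>i. \<mu> < card {..i} \<longrightarrow> 0 < B (a i) (a i)))"

definition base_set ::
    "('a::euclidean_space \<Rightarrow> 'a \<Rightarrow> real) \<Rightarrow> 'a set \<Rightarrow> ('k::finite \<Rightarrow> 'a) \<Rightarrow> 'a \<Rightarrow> 'a set" where
  "base_set B V0 a c = {c + p | p. p \<in> V0 \<and> (\<forall>i. B (a i) p > 0)}"

definition warp ::
    "('a::euclidean_space \<Rightarrow> 'a \<Rightarrow> real) \<Rightarrow> ('k::finite \<Rightarrow> 'a) \<Rightarrow> 'a \<Rightarrow> 'k \<Rightarrow> 'a \<Rightarrow> real" where
  "warp B a c i p0 = B (a i) (p0 - c)"

definition warped_map ::
    "('k::finite \<Rightarrow> 'a::euclidean_space \<Rightarrow> real) \<Rightarrow> 'a \<Rightarrow> 'a \<times> ('a ^ 'k) \<Rightarrow> 'a" where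
  "warped_map \<rho> pbar z = fst z + (\<Sum>i\<in>UNIV. \<rho> i (fst z) *\<^sub>R (snd z $ i - pbar))"

end

theory Submission
  imports Defs
begin

text \<open>
  In the non-null case \<open>c\<close> is the common centre of all the quadrics \<open>N\<^sub>i\<close>. With \<open>w\<^sub>i = p\<^sub>i - pbar + a\<^sub>i / \<kappa>\<^sub>i \<in> W\<^sub>i\<close>,
  the \<open>W\<^sub>i\<close>-component of \<open>\<psi> - c\<close> is \<open>\<rho>\<^sub>i w\<^sub>i\<close> with \<open>w\<^sub>i\<^sup>2 = 1 / \<kappa>\<^sub>i\<close>, so \<open>\<rho>\<^sub>i\<close> and \<open>w\<^sub>i\<close> are polar coordinates in
  \<open>W\<^sub>i\<close>: \<open>\<rho>\<^sub>i = \<surd>(\<kappa>\<^sub>i P\<^sub>i\<^sup>2)\<close>. In the null case \<open>\<rho> = \<langle>a, \<psi> - c\<rangle>\<close>, and the \<open>V\<^sub>1\<close>-component of \<open>\<psi> - c\<close> is \<open>\<rho>\<close> times the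
  parameter of the paraboloid \<open>N\<^sub>1\<close>. In both cases \<open>\<psi>\<close> is a polynomial with an inverse that is smooth on the
  open image; this inverse parametrises the warped product globally and hence determines its tangent
  spaces, to which the form is transported from the image.
\<close>

section \<open>Calculus of \<open>C\<^sup>k\<close> maps\<close>

text \<open>The candidate derivative is known to agree with \<open>frechet_derivative\<close> only
  on \<open>U\<close>, so the last premise covers every function equal to it there. Invariance under
  such a change is not presupposed: \<open>Ck_on_cong\<close> is derived from this rule.\<close>

lemma Ck_on_SucI_cong:
  assumes "\<And>x. x \<in> U \<Longrightarrow> (f has_derivative f' x) (at x)" and "open U"
    and "\<And>g v. (\<And>x. x \<in> U \<Longrightarrow> g x = f' x v) \<Longrightarrow> Ck_on n g U"
  shows "Ck_on (Suc n) f U"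
proof -
  have "frechet_derivative f (at x) = f' x" if "x \<in> U" for x
    using frechet_derivative_at[OF assms(1)[OF that]] by simp
  then have "Ck_on n (\<lambda>x. frechet_derivative f (at x) v) U" for v
    by (intro assms(3)) simp
  moreover have "\<forall>x\<in>U. f differentiable at x"
    using assms(1) unfolding differentiable_def by blast
  ultimately show ?thesis by simp
qed

lemma Ck_on_SucD:
  assumes "Ck_on (Suc n) f U"
  shows "x \<in> U \<Longrightarrow> (f has_derivative frechet_derivative f (at x)) (at x)"
    and "Ck_on n (\<lambda>x. frechet_derivative f (at x) v) U"
  using assms frechet_derivative_works by auto

lemma Ck_on_cong:
  assumes "open U" "\<And>x. x \<in> U \<Longrightarrow> f x = g x" "Ck_on n f U"
  shows "Ck_on n g U"
  using assms(2,3)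
proof (induction n arbitrary: f g)
  case 0
  then show ?case using continuous_on_cong by fastforce
next
  case (Suc n)
  show ?case
  proof (rule Ck_on_SucI_cong)
    fix x assume "x \<in> U"
    then show "(g has_derivative frechet_derivative f (at x)) (at x)"
      using has_derivative_transform_within_open[OF Ck_on_SucD(1)[OF Suc.prems(2)] assms(1)] Suc.prems(1)
      by blast
  next
    fix h v assume "\<And>x. x \<in> U \<Longrightarrow> h x = frechet_derivative f (at x) v"
    then show "Ck_on n h U"
      by (intro Suc.IH[OF _ Ck_on_SucD(2)[OF Suc.prems(2), of v]]) simp
  qed fact
qed

lemma Ck_on_SucI:
  assumes "\<And>x. x \<in> U \<Longrightarrow> (f has_derivative f' x) (at x)" and "open U"
    and "\<And>v. Ck_on n (\<lambda>x. f' x v) U"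
  shows "Ck_on (Suc n) f U"
  by (rule Ck_on_SucI_cong[OF assms(1,2)]) (use Ck_on_cong[OF assms(2) _ assms(3)] in force)+

lemma Ck_on_Suc_le: "Ck_on (Suc n) f U \<Longrightarrow> Ck_on n f U"
proof (induction n arbitrary: f)
  case 0
  then show ?case
    by (auto intro!: continuous_at_imp_continuous_on differentiable_imp_continuous_within)
next
  case (Suc n)
  then show ?case by (metis Ck_on.simps(2))
qed

lemma Ck_on_const: "open U \<Longrightarrow> Ck_on n (\<lambda>x. c) U"
proof (induction n arbitrary: c)
  case (Suc n)
  show ?case by (rule Ck_on_SucI[where f' = "\<lambda>_ _. 0"]) (use Suc in auto)
qed simp

lemma Ck_on_bounded_linear:
  assumes "bounded_linear L" "open U"
  shows "Ck_on n f U \<Longrightarrow> Ck_on n (\<lambda>x. L (f x)) U"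
proof (induction n arbitrary: f)
  case 0
  then show ?case using assms(1) bounded_linear.continuous_on by auto
next
  case (Suc n)
  show ?case
    by (rule Ck_on_SucI[where f' = "\<lambda>x v. L (frechet_derivative f (at x) v)"])
      (use Ck_on_SucD[OF Suc.prems] Suc.IH assms bounded_linear.has_derivative in blast)+
qed

lemma Ck_on_ident: "open U \<Longrightarrow> Ck_on n (\<lambda>x. x) U"
proof (induction n)
  case (Suc n)
  show ?case
    by (rule Ck_on_SucI[where f' = "\<lambda>_ v. v"]) (use Suc Ck_on_const in \<open>auto intro: has_derivative_ident\<close>)
qed simp

lemma Ck_on_linear: "linear L \<Longrightarrow> open U \<Longrightarrow> Ck_on n f U \<Longrightarrow> Ck_on n (\<lambda>x. L (f x)) U"
  by (simp add: Ck_on_bounded_linear linear_conv_bounded_linear)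

lemma Ck_on_add:
  assumes "open U"
  shows "Ck_on n f U \<Longrightarrow> Ck_on n g U \<Longrightarrow> Ck_on n (\<lambda>x. f x + g x) U"
proof (induction n arbitrary: f g)
  case 0
  then show ?case by (auto intro: continuous_intros)
next
  case (Suc n)
  show ?case
    by (rule Ck_on_SucI[where f' = "\<lambda>x v. frechet_derivative f (at x) v + frechet_derivative g (at x) v"])
      (use Ck_on_SucD[OF Suc.prems(1)] Ck_on_SucD[OF Suc.prems(2)] Suc.IH assms has_derivative_add in blast)+
qed

lemma Ck_on_sum:
  assumes "open U" "\<And>i. i \<in> I \<Longrightarrow> Ck_on n (f i) U"
  shows "Ck_on n (\<lambda>x. \<Sum>i\<in>I. f i x) U"
  using assms(2)
  by (induction I rule: infinite_finite_induct) (auto simp: assms(1) Ck_on_const Ck_on_add)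

text \<open>By the product rule a directional derivative is a sum of two such products, each of a
  derivative and an undifferentiated factor weakened to the same order.\<close>

lemma Ck_on_bounded_bilinear:
  assumes "bounded_bilinear h" "open U"
  shows "Ck_on n f U \<Longrightarrow> Ck_on n g U \<Longrightarrow> Ck_on n (\<lambda>x. h (f x) (g x)) U"
proof (induction n arbitrary: f g)
  case 0
  then show ?case using bounded_bilinear.continuous_on[OF assms(1)] by auto
next
  case (Suc n)
  show ?case
  proof (rule Ck_on_SucI[where f' = "\<lambda>x v. h (f x) (frechet_derivative g (at x) v)
      + h (frechet_derivative f (at x) v) (g x)"])
    fix x assume "x \<in> U"
    then show "((\<lambda>x. h (f x) (g x)) has_derivative (\<lambda>v. h (f x) (frechet_derivative g (at x) v)
      + h (frechet_derivative f (at x) v) (g x))) (at x)"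
      using Ck_on_SucD(1)[OF Suc.prems(1)] Ck_on_SucD(1)[OF Suc.prems(2)]
        bounded_bilinear.FDERIV[OF assms(1)] by blast
  next
    fix v
    show "Ck_on n (\<lambda>x. h (f x) (frechet_derivative g (at x) v)
      + h (frechet_derivative f (at x) v) (g x)) U"
      by (intro Ck_on_add[OF assms(2)]
          Suc.IH[OF Ck_on_Suc_le[OF Suc.prems(1)] Ck_on_SucD(2)[OF Suc.prems(2)]]
          Suc.IH[OF Ck_on_SucD(2)[OF Suc.prems(1)] Ck_on_Suc_le[OF Suc.prems(2)]])
  qed fact
qed

lemma Ck_on_bilinear:
  "bilinear h \<Longrightarrow> open U \<Longrightarrow> Ck_on n f U \<Longrightarrow> Ck_on n g U \<Longrightarrow> Ck_on n (\<lambda>x. h (f x) (g x)) U"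
  by (simp add: Ck_on_bounded_bilinear bilinear_conv_bounded_bilinear)

text \<open>The exponent varies in the induction because differentiation lowers it by one. Real
  powers of a positive function cover the square root, its reciprocal and the plain
  reciprocal.\<close>

lemma Ck_on_powr:
  fixes f :: "'a::euclidean_space \<Rightarrow> real"
  assumes "open U" "\<And>x. x \<in> U \<Longrightarrow> 0 < f x"
  shows "Ck_on n f U \<Longrightarrow> Ck_on n (\<lambda>x. f x powr r) U"
proof (induction n arbitrary: r)
  case 0
  then show ?case using assms by (force intro: continuous_on_powr continuous_on_const)
next
  case (Suc n)
  show ?case
  proof (rule Ck_on_SucI[where f' = "\<lambda>x v. (r * f x powr (r - 1)) * frechet_derivative f (at x) v"])
    fix x assume x: "x \<in> U"
    show "((\<lambda>x. f x powr r) has_derivative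
        (\<lambda>v. (r * f x powr (r - 1)) * frechet_derivative f (at x) v)) (at x)"
      by (rule has_derivative_eq_rhs[OF
            DERIV_compose_FDERIV[OF has_real_derivative_powr[OF assms(2)[OF x]]
              Ck_on_SucD(1)[OF Suc.prems x]]])
        (simp add: mult_ac)
  next
    fix v
    have "Ck_on n (\<lambda>x. f x powr (r - 1)) U"
      by (rule Suc.IH[OF Ck_on_Suc_le[OF Suc.prems]])
    then show "Ck_on n (\<lambda>x. r * f x powr (r - 1) * frechet_derivative f (at x) v) U"
      using Ck_on_SucD(2)[OF Suc.prems] assms(1)
      by (intro Ck_on_bounded_bilinear[OF bounded_bilinear_mult] Ck_on_const)
  qed fact
qed

lemma Ck_on_Pair:
  assumes "open U" "Ck_on n f U" "Ck_on n g U"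
  shows "Ck_on n (\<lambda>x. (f x, g x)) U"
proof -
  have "Ck_on n (\<lambda>x. (f x, 0) + (0, g x)) U"
    by (intro Ck_on_add assms Ck_on_linear[where L = "\<lambda>y. (y, 0)"] Ck_on_linear[where L = "\<lambda>y. (0, y)"])
      (auto intro!: linearI)
  then show ?thesis by simp
qed

lemma Ck_on_vec_lambda:
  fixes f :: "'k::finite \<Rightarrow> 'a::euclidean_space \<Rightarrow> 'b::euclidean_space"
  assumes "open U" "\<And>i. Ck_on n (f i) U"
  shows "Ck_on n (\<lambda>x. \<chi> i. f i x) U"
proof -
  have "Ck_on n (\<lambda>x. \<Sum>i\<in>UNIV. axis i (f i x)) U"
    by (intro Ck_on_sum Ck_on_linear[where L = "axis _"] assms)
      (auto intro!: linearI simp: vec_eq_iff axis_def)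
  moreover have "(\<Sum>i\<in>UNIV. axis i (f i x)) = (\<chi> i. f i x)" for x
    by (simp add: vec_eq_iff axis_def)
  ultimately show ?thesis by simp
qed

text \<open>The inner derivative is the constant \<open>L\<close>, so every directional derivative
  is again of this form. The lemma serves for straight lines and for the projection onto a
  factor.\<close>

lemma Ck_on_compose_affine:
  assumes "bounded_linear L" "open U" "open U'" "\<And>x. x \<in> U' \<Longrightarrow> L x + b \<in> U"
  shows "Ck_on n f U \<Longrightarrow> Ck_on n (\<lambda>x. f (L x + b)) U'"
proof (induction n arbitrary: f)
  case 0
  have "continuous_on U' (\<lambda>x. L x + b)"
    using assms(1) by (intro continuous_intros bounded_linear.continuous_on[OF assms(1)])
  then show ?case
    using continuous_on_compose2[of U f U' "\<lambda>x. L x + b"] 0 assms(4) by (simp add: image_subset_iff)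
next
  case (Suc n)
  show ?case
  proof (rule Ck_on_SucI[where f' = "\<lambda>x v. frechet_derivative f (at (L x + b)) (L v)"])
    fix x assume "x \<in> U'"
    moreover have "((\<lambda>x. L x + b) has_derivative L) (at x)"
      using bounded_linear_imp_has_derivative[OF assms(1)] has_derivative_add_const by blast
    ultimately show "((\<lambda>x. f (L x + b)) has_derivative
        (\<lambda>v. frechet_derivative f (at (L x + b)) (L v))) (at x)"
      by (intro has_derivative_compose[of "\<lambda>x. L x + b" L x UNIV f] Ck_on_SucD(1)[OF Suc.prems] assms(4))
  qed (rule assms(3), rule Suc.IH[OF Ck_on_SucD(2)[OF Suc.prems]])
qed

section \<open>Tangent spaces and isometries onto open sets\<close>

lemma smooth_onI:  assumes "open U" "S \<subseteq> U" "\<And>n. Ck_on n F U" "\<And>x. x \<in> S \<Longrightarrow> F x = f x"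
  shows "smooth_on S f"
  unfolding smooth_on_def using assms by blast

text \<open>Along a curve in \<open>M\<close> with velocity \<open>v\<close> the function is
  constant; the chain rule and uniqueness of derivatives do the rest.\<close>

lemma tangent_space_const_on:
  assumes "v \<in> tangent_space M x" "(f has_derivative D) (at x)" "\<And>y. y \<in> M \<Longrightarrow> f y = c"
  shows "D v = 0"
proof -
  obtain \<gamma> \<epsilon> where \<gamma>: "\<epsilon> > 0" "\<gamma> ` {-\<epsilon><..<\<epsilon>} \<subseteq> M" "\<gamma> (0::real) = x"
      "(\<gamma> has_vector_derivative v) (at 0)"
    using assms(1) by (auto simp: tangent_space_def)
  have "((\<lambda>t. f (\<gamma> t)) has_derivative (\<lambda>t. D (t *\<^sub>R v))) (at 0)"
    using has_derivative_compose[of \<gamma> "\<lambda>t. t *\<^sub>R v" 0 UNIV f D] \<gamma> assms(2)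
    by (simp add: has_vector_derivative_def)
  then have "((\<lambda>_. c) has_derivative (\<lambda>t. D (t *\<^sub>R v))) (at (0::real))"
    by (rule has_derivative_transform_within_open[of _ _ _ _ "{-\<epsilon><..<\<epsilon>}"])
      (use \<gamma> assms(3) in \<open>auto simp: image_subset_iff\<close>)
  then have "(\<lambda>t. D (t *\<^sub>R v)) = (\<lambda>_. 0)"
    using has_derivative_unique has_derivative_const by blast
  then show ?thesis by (metis scaleR_one)
qed

text \<open>The map \<open>h (f z) - z\<close> vanishes on \<open>M\<close>, so its derivative kills
  tangent vectors, which puts them in the range. Conversely, \<open>h\<close> turns a straight line
  in \<open>N\<close> into a curve in \<open>M\<close> with the prescribed velocity.\<close>

lemma tangent_space_parametrised:
  assumes "open N" "\<And>n. Ck_on n h N" "h ` N \<subseteq> M" "x \<in> M"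
    and "\<And>z. z \<in> M \<Longrightarrow> f z \<in> N \<and> h (f z) = z" "f differentiable (at x)"
  shows "tangent_space M x = range (frechet_derivative h (at (f x)))"
proof -
  let ?A = "frechet_derivative h (at (f x))" and ?D = "frechet_derivative f (at x)"
  have N: "f x \<in> N" and hfx: "h (f x) = x" using assms(4,5) by auto
  have h': "(h has_derivative ?A) (at (f x))"
    using Ck_on_SucD(1)[OF assms(2)] N by blast
  have f': "(f has_derivative ?D) (at x)"
    using assms(6) frechet_derivative_works by blast
  show ?thesis
  proof (intro equalityI subsetI)
    fix v assume v: "v \<in> tangent_space M x"
    have "((\<lambda>z. h (f z) - z) has_derivative (\<lambda>u. ?A (?D u) - u)) (at x)"
      using has_derivative_compose[OF f' h'] by (intro derivative_intros)
    from tangent_space_const_on[OF v this, of 0] have "?A (?D v) - v = 0"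
      using assms(5) by simp
    then show "v \<in> range ?A" by (metis eq_iff_diff_eq_0 rangeI)
  next
    fix v assume "v \<in> range ?A"
    then obtain w where w: "v = ?A w" by blast
    let ?S = "(\<lambda>t::real. t *\<^sub>R w + f x) -` N"
    have "open ?S" by (intro continuous_open_vimage assms continuous_intros)
    moreover have "0 \<in> ?S" using N by simp
    ultimately obtain \<epsilon> where \<epsilon>: "\<epsilon> > 0" "ball 0 \<epsilon> \<subseteq> ?S" by (meson openE)
    then have sub: "t *\<^sub>R w + f x \<in> N" if "t \<in> {-\<epsilon><..<\<epsilon>}" for t
      using that by (auto simp: subset_iff abs_less_iff)
    let ?\<gamma> = "\<lambda>t. h (t *\<^sub>R w + f x)"
    have "\<And>n. Ck_on n ?\<gamma> {-\<epsilon><..<\<epsilon>}"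
      by (rule Ck_on_compose_affine[OF bounded_linear_scaleR_left assms(1) _ _ assms(2)]) (use sub in auto)
    then have "smooth_on {-\<epsilon><..<\<epsilon>} ?\<gamma>"
      by (intro smooth_onI[of "{-\<epsilon><..<\<epsilon>}"]) auto
    moreover have "(?\<gamma> has_vector_derivative v) (at 0)"
    proof -
      have "((\<lambda>t. t *\<^sub>R w + f x) has_derivative (\<lambda>t. t *\<^sub>R w)) (at (0::real))"
        by (auto intro!: derivative_eq_intros)
      from has_derivative_compose[OF this, of h ?A] h'
      have "(?\<gamma> has_derivative (\<lambda>t. ?A (t *\<^sub>R w))) (at 0)" by simp
      moreover have "?A (t *\<^sub>R w) = t *\<^sub>R v" for t
        using h' has_derivative_linear linear_cmul w by blast
      ultimately show ?thesis by (simp add: has_vector_derivative_def)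
    qed
    ultimately show "v \<in> tangent_space M x"
      using \<epsilon>(1) sub assms(3) hfx unfolding tangent_space_def
      by (intro CollectI exI[of _ ?\<gamma>] exI[of _ \<epsilon>]) auto
  qed
qed

text \<open>An orthogonal basis is carried over by \<open>A\<close> with the signs of its squares,
  hence with the index.\<close>

lemma scalar_product_on_image:
  assumes "scalar_product_on T B \<nu>" "linear A" "inj A" "bilinear g" "\<And>u v. g u v = g v u"
    and "\<And>u v. u \<in> T \<Longrightarrow> v \<in> T \<Longrightarrow> g (A u) (A v) = B u v"
  shows "scalar_product_on (A ` T) g \<nu>"
proof -
  obtain E where E: "independent E" "span E = T" "\<forall>x\<in>E. \<forall>y\<in>E. x \<noteq> y \<longrightarrow> B x y = 0"
      "card {x\<in>E. B x x < 0} = \<nu>"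
    using assms(1) by (auto simp: scalar_product_on_def)
  have ET: "E \<subseteq> T" using E(2) span_superset by blast
  have "{x\<in>A ` E. g x x < 0} = A ` {x\<in>E. B x x < 0}"
    using assms(6) ET by auto
  then have "card {x\<in>A ` E. g x x < 0} = \<nu>"
    using E(4) card_image[OF inj_on_subset[OF assms(3)]] by simp
  moreover have "independent (A ` E)"
    using linear_independent_injective_image[OF assms(2) E(1)] inj_on_subset[OF assms(3)] by blast
  moreover have "span (A ` E) = A ` T"
    using E(2) assms(2) linear_span_image by blast
  moreover have "\<forall>x\<in>A ` E. \<forall>y\<in>A ` E. x \<noteq> y \<longrightarrow> g x y = 0"
    using E(3) ET assms(6) by (auto simp: subset_iff)
  moreover have "\<forall>x\<in>A ` T. (\<forall>y\<in>A ` T. g x y = 0) \<longrightarrow> x = 0"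
    using assms(1,6) linear_0[OF assms(2)] by (auto simp: scalar_product_on_def)
  moreover have "subspace (A ` T)"
    using assms(1,2) linear_subspace_image scalar_product_on_def by blast
  ultimately show ?thesis
    using assms(4,5) unfolding scalar_product_on_def by blast
qed

lemma tangent_space_open:
  assumes "open N" "x \<in> N"
  shows "tangent_space N x = UNIV"
proof -
  have "tangent_space N x = range (frechet_derivative (\<lambda>x. x) (at x))"
    using assms Ck_on_ident[OF assms(1)]
    by (intro tangent_space_parametrised[where f = "\<lambda>x. x" and N = N]) auto
  then show ?thesis by simp
qed

lemma submanifold_open:
  fixes N :: "'e::euclidean_space set"
  assumes "open N"
  shows "submanifold DIM('e) N"
  unfolding submanifold_def
proof
  fix x assume "x \<in> N"
  have "bij_betw (\<lambda>x. x) N N" by (simp add: bij_betw_def inj_on_def)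
  moreover have "smooth_on N (\<lambda>x. x)"
    by (rule smooth_onI[of N _ "\<lambda>x. x"]) (use assms Ck_on_ident in auto)
  moreover have "smooth_on N (inv_into N (\<lambda>x. x))"
    by (rule smooth_onI[of N _ "\<lambda>x. x"]) (use assms Ck_on_ident inv_into_f_f[of "\<lambda>x. x" N] in \<open>auto simp: inj_on_def\<close>)
  ultimately show "\<exists>U L \<Omega> \<phi>. open U \<and> x \<in> U \<and> subspace L \<and> dim L = DIM('e) \<and>
        openin (top_of_set L) \<Omega> \<and> diffeomorphism_onto (N \<inter> U) (\<Omega> :: 'e set) \<phi>"
    using assms \<open>x \<in> N\<close>
    by (intro exI[of _ UNIV] exI[of _ N] exI[of _ "\<lambda>x. x"]) (auto simp: diffeomorphism_onto_def)
qed

lemma pseudo_riemannian_open: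
  fixes N :: "'e::euclidean_space set"
  assumes "open N" "scalar_product_on UNIV B \<nu>"
  shows "pseudo_riemannian DIM('e) \<nu> N (\<lambda>_. B)"
  unfolding pseudo_riemannian_def
  using assms by (auto simp: submanifold_open tangent_space_open Ck_on_const intro!: smooth_onI[of UNIV])

text \<open>The map \<open>f\<close> is itself a global chart of \<open>M\<close>, and the
  derivative of its inverse \<open>h\<close> carries \<open>B\<close> to \<open>g z\<close> on the
  tangent space; this yields non-degeneracy and the index.\<close>

lemma isometry_onto_openI:
  fixes f :: "'a::euclidean_space \<times> 'b::euclidean_space \<Rightarrow> 'a"
  assumes N: "open N" and f: "\<And>n. Ck_on n f UNIV" and h: "\<And>n. Ck_on n h N"
    and fM: "\<And>z. z \<in> M \<Longrightarrow> f z \<in> N \<and> h (f z) = z"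
    and hN: "\<And>y. y \<in> N \<Longrightarrow> h y \<in> M \<and> f (h y) = y"
    and B: "scalar_product_on UNIV B \<nu>"
    and g: "\<And>z. z \<in> M \<Longrightarrow> bilinear (g z)" "\<And>z u v. z \<in> M \<Longrightarrow> g z u v = g z v u"
      "\<And>u v n. Ck_on n (\<lambda>z. g z u v) UNIV"
    and D: "\<And>z. z \<in> M \<Longrightarrow> (f has_derivative D z) (at z)"
    and iso: "\<And>z u v. z \<in> M \<Longrightarrow> u \<in> tangent_space M z \<Longrightarrow> v \<in> tangent_space M z \<Longrightarrow>
      B (D z u) (D z v) = g z u v"
  shows "isometry_onto M g N (\<lambda>_. B) f"
proof -
  have bij: "bij_betw f M N"
    by (rule bij_betw_byWitness[where f' = h]) (use fM hN in auto)
  have inv: "inv_into M f y = h y" if "y \<in> N" for y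
    using that hN fM bij by (metis bij_betw_imp_inj_on inv_into_f_f)
  have diffeo: "diffeomorphism_onto M N f"
    unfolding diffeomorphism_onto_def
    using bij smooth_onI[of UNIV M f f] smooth_onI[of N N h "inv_into M f"] f h N inv by auto
  have "submanifold DIM('a) M"
    unfolding submanifold_def
  proof
    fix z assume "z \<in> M"
    \<comment> \<open>The model of a chart has to be a subspace of the ambient
      \<open>'a \<times> 'b\<close>, so \<open>N\<close> is placed there as
      \<open>N \<times> {0}\<close>.\<close>
    let ?L = "range (\<lambda>y::'a. (y, 0::'b))" and ?\<phi> = "\<lambda>z. (f z, 0::'b)"
    have lin: "linear (\<lambda>y::'a. (y, 0::'b))" by (auto intro!: linearI)
    have inj: "inj (\<lambda>y::'a. (y, 0::'b))" by (auto intro!: injI)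
    have bij': "bij_betw ?\<phi> M (N \<times> {0})"
      by (rule bij_betw_byWitness[where f' = "h \<circ> fst"]) (use fM hN in auto)
    have inv': "inv_into M ?\<phi> y = h (fst y)" if "y \<in> N \<times> {0}" for y
    proof -
      have "?\<phi> (h (fst y)) = y" "h (fst y) \<in> M" using that hN by auto
      then show ?thesis using bij' by (intro inv_into_f_eq) (auto simp: bij_betw_def)
    qed
    have "Ck_on n (\<lambda>y. h (fst y + 0)) (N \<times> (UNIV :: 'b set))" for n
      by (rule Ck_on_compose_affine[OF bounded_linear_fst N _ _ h]) (use N in \<open>auto intro: open_Times\<close>)
    then have "smooth_on (N \<times> {0}) (inv_into M ?\<phi>)"
      using inv' N by (intro smooth_onI[of "N \<times> UNIV" _ "\<lambda>y. h (fst y)"]) (auto intro: open_Times)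
    moreover have "smooth_on M ?\<phi>"
      using f by (intro smooth_onI[of UNIV _ ?\<phi>] Ck_on_Pair Ck_on_const) auto
    ultimately have "diffeomorphism_onto (M \<inter> UNIV) (N \<times> {0}) ?\<phi>"
      using bij' by (simp add: diffeomorphism_onto_def)
    moreover have "subspace ?L" by (rule linear_subspace_image[OF lin subspace_UNIV])
    moreover have "dim ?L = DIM('a)"
      using dim_image_eq[OF lin, of UNIV] inj by auto
    moreover have "openin (top_of_set ?L) (N \<times> {0})"
    proof -
      have "N \<times> {0} = ?L \<inter> (N \<times> UNIV)" by auto
      then show ?thesis using N by (metis openin_open open_Times open_UNIV)
    qed
    ultimately show "\<exists>U L \<Omega> \<phi>. open U \<and> z \<in> U \<and> subspace L \<and> dim L = DIM('a) \<and>
        openin (top_of_set L) \<Omega> \<and> diffeomorphism_onto (M \<inter> U) (\<Omega> :: ('a \<times> 'b) set) \<phi>"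
      by blast
  qed
  moreover have "scalar_product_on (tangent_space M z) (g z) \<nu>" if z: "z \<in> M" for z
  proof -
    let ?A = "frechet_derivative h (at (f z))"
    have h': "(h has_derivative ?A) (at (f z))"
      using Ck_on_SucD(1)[OF h] fM z by blast
    have T: "tangent_space M z = range ?A"
      using tangent_space_parametrised[OF N h _ z fM] hN D[OF z] by (auto simp: differentiable_def)
    \<comment> \<open>Differentiating \<open>f (h y) = y\<close> on the open set \<open>N\<close>
      makes \<open>D z\<close> a left inverse of \<open>?A\<close>. Hence \<open>?A\<close> is
      injective and, by \<open>iso\<close>, pulls \<open>g z\<close> back to
      \<open>B\<close>.\<close>
    have "((\<lambda>y. f (h y)) has_derivative (\<lambda>u. D z (?A u))) (at (f z))"
      using has_derivative_compose[OF h', of f] D[OF z] fM[OF z] by simp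
    then have "((\<lambda>y. y) has_derivative (\<lambda>u. D z (?A u))) (at (f z))"
      by (rule has_derivative_transform_within_open[OF _ N]) (use fM z hN in auto)
    then have DA: "D z (?A u) = u" for u
      by (metis has_derivative_ident has_derivative_unique)
    have "linear ?A" using h' has_derivative_linear by blast
    moreover have "inj ?A" using DA by (metis injI)
    moreover have "g z (?A u) (?A v) = B u v" for u v
      using iso[OF z, of "?A u" "?A v"] T DA by simp
    ultimately show ?thesis
      unfolding T using scalar_product_on_image[OF B] g(1,2)[OF z] by blast
  qed
  moreover have "smooth_on M (\<lambda>z. g z u v)" for u v
    using g(3) by (intro smooth_onI[of UNIV]) auto
  ultimately have "pseudo_riemannian DIM('a) \<nu> M g"
    by (simp add: pseudo_riemannian_def)
  moreover have "\<exists>D. (f has_derivative D) (at z within M) \<and>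
      (\<forall>u\<in>tangent_space M z. \<forall>v\<in>tangent_space M z. B (D u) (D v) = g z u v)" if "z \<in> M" for z
    using D[OF that] iso[OF that] has_derivative_at_withinI by blast
  ultimately show ?thesis
    unfolding isometry_onto_def using diffeo pseudo_riemannian_open[OF N B] by blast
qed

section \<open>Linear and quadratic constraints on tangent vectors\<close>

lemma tangent_space_linear_const:
  fixes L :: "'a::euclidean_space \<Rightarrow> 'b::euclidean_space"
  assumes "v \<in> tangent_space M x" "linear L" "\<And>y. y \<in> M \<Longrightarrow> L y = c"
  shows "L v = 0"
  using tangent_space_const_on[OF assms(1) linear_imp_has_derivative[OF assms(2)] assms(3)] .

text \<open>A subspace is the common kernel of the functionals \<open>w \<bullet> _\<close> with
  \<open>w\<close> in its Euclidean orthogonal complement, and each of them composed with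
  \<open>L\<close> is constant on \<open>M\<close>. The orthogonality here is that of the type
  class, not of a pseudo-Euclidean form.\<close>

lemma tangent_space_linear_subspace:
  fixes L :: "'a::euclidean_space \<Rightarrow> 'b::euclidean_space"
  assumes v: "v \<in> tangent_space M x" and L: "linear L" and S: "subspace S"
    and c: "\<And>y. y \<in> M \<Longrightarrow> L y - c \<in> S"
  shows "L v \<in> S"
proof -
  have "w \<bullet> L v = 0" if w: "w \<in> orthogonal_comp S" for w
  proof (rule tangent_space_linear_const[OF v, where c = "w \<bullet> c"])
    show "linear (\<lambda>u. w \<bullet> L u)"
      using linear_compose[OF L, of "\<lambda>u. w \<bullet> u"] by (simp add: o_def bounded_linear_inner_right bounded_linear.linear)
    fix y assume "y \<in> M"
    then have "(L y - c) \<bullet> w = 0"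
      using c w by (auto simp: orthogonal_comp_def orthogonal_def)
    then show "w \<bullet> L y = w \<bullet> c"
      by (simp add: inner_diff_left inner_commute[of w])
  qed
  then have "L v \<in> orthogonal_comp (orthogonal_comp S)"
    by (auto simp: orthogonal_comp_def orthogonal_def)
  then show ?thesis using orthogonal_comp_self[OF S] by simp
qed

text \<open>Differentiating the quadratic equation gives twice this value, by symmetry of
  \<open>h\<close>.\<close>

lemma tangent_space_quadric:
  fixes L :: "'a::euclidean_space \<Rightarrow> 'b::euclidean_space" and h :: "'b \<Rightarrow> 'b \<Rightarrow> real"
  assumes v: "v \<in> tangent_space M x" and L: "linear L" and h: "bilinear h" "\<And>x y. h x y = h y x"
    and c: "\<And>y. y \<in> M \<Longrightarrow> h (L y - m) (L y - m) = c"
  shows "h (L x - m) (L v) = 0"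
proof -
  interpret h: bounded_bilinear h using h(1) by (simp add: bilinear_conv_bounded_bilinear)
  have L': "((\<lambda>y. L y - m) has_derivative L) (at x)"
    using linear_imp_has_derivative[OF L] by (auto intro!: derivative_eq_intros)
  have "h (L x - m) (L v) + h (L v) (L x - m) = 0"
    using tangent_space_const_on[OF v h.FDERIV[OF L' L'] c] .
  then show ?thesis using h(2)[of "L v"] by simp
qed

lemma linear_snd_nth: "linear (\<lambda>z. snd z $ i)"
  by (auto intro!: linearI)

lemma Ck_on_diff_const:
  assumes "open U" "Ck_on n f U"
  shows "Ck_on n (\<lambda>x. f x - c) U"
  using Ck_on_add[OF assms Ck_on_const[OF assms(1), of n "- c"]] by simp

lemma Ck_on_fst_diff: "Ck_on n (\<lambda>z. fst z - c) UNIV"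
  and Ck_on_snd_diff: "Ck_on n (\<lambda>z. snd z $ i - c') UNIV"
  by (intro Ck_on_diff_const Ck_on_linear[OF linear_fst] Ck_on_linear[OF linear_snd_nth] Ck_on_ident open_UNIV)+

lemma subspace_line_plus: "subspace V \<Longrightarrow> subspace (line_plus a V)"
proof -
  assume "subspace V"
  moreover have "line_plus a V = {x + y |x y. x \<in> span {a} \<and> y \<in> V}"
    unfolding line_plus_def span_singleton by blast
  ultimately show ?thesis using subspace_sums[OF subspace_span[of "{a}"], of V] by simp
qed

section \<open>Orthogonal decompositions and warped maps\<close>

text \<open>The description is proper by the unique existence in
  \<open>orthogonal_decomposition\<close>.\<close>

definition component :: "'a::euclidean_space set \<Rightarrow> ('k::finite \<Rightarrow> 'a set) \<Rightarrow> 'a \<Rightarrow> 'a \<times> ('a ^ 'k)" where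
  "component V0 V x = (THE w. fst w \<in> V0 \<and> (\<forall>i. snd w $ i \<in> V i) \<and> x = fst w + (\<Sum>i\<in>UNIV. snd w $ i))"

text \<open>The differential of \<open>warped_map\<close> at \<open>z\<close> by the product rule:
  \<open>B (a i)\<close> is the linear part of the affine function
  \<open>warp B a c i\<close>.\<close>

definition warped_deriv ::
    "('a::euclidean_space \<Rightarrow> 'a \<Rightarrow> real) \<Rightarrow> ('k::finite \<Rightarrow> 'a) \<Rightarrow> 'a \<Rightarrow> 'a \<Rightarrow> 'a \<times> ('a ^ 'k) \<Rightarrow> 'a \<times> ('a ^ 'k) \<Rightarrow> 'a" where
  "warped_deriv B a c pbar z u = fst u + (\<Sum>i\<in>UNIV. B (a i) (fst u) *\<^sub>R (snd z $ i - pbar)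
     + B (a i) (fst z - c) *\<^sub>R (snd u $ i))"

locale decomposed_space =
  fixes B :: "'a::euclidean_space \<Rightarrow> 'a \<Rightarrow> real" and \<nu> :: nat
    and V0 :: "'a set" and V :: "'k::finite \<Rightarrow> 'a set" and a :: "'k \<Rightarrow> 'a" and pbar :: 'a
  assumes form: "scalar_product_on UNIV B \<nu>"
    and decomp: "orthogonal_decomposition B V0 V"
    and a_in: "\<And>i. a i \<in> V0"
    and a_orth: "\<And>i j. i \<noteq> j \<Longrightarrow> B (a i) (a j) = 0"
begin

lemma bilin: "bilinear B" and sym: "B x y = B y x" and nondeg: "(\<And>y. B x y = 0) \<Longrightarrow> x = 0"
  using form by (auto simp: scalar_product_on_def)

sublocale B: bounded_bilinear B
  using bilin by (simp add: bilinear_conv_bounded_bilinear)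

lemma sub0: "subspace V0" and sub: "subspace (V i)"
  and orth0: "x \<in> V0 \<Longrightarrow> y \<in> V i \<Longrightarrow> B x y = 0"
  and orth: "i \<noteq> j \<Longrightarrow> x \<in> V i \<Longrightarrow> y \<in> V j \<Longrightarrow> B x y = 0"
  using decomp unfolding orthogonal_decomposition_def by blast+

abbreviation "q0 x \<equiv> fst (component V0 V x)"
abbreviation "q i x \<equiv> snd (component V0 V x) $ i"

lemma component_ex1:
  "\<exists>!w. fst w \<in> V0 \<and> (\<forall>i. snd w $ i \<in> V i) \<and> x = fst w + (\<Sum>i\<in>UNIV. snd w $ i)"
  using decomp unfolding orthogonal_decomposition_def by (elim conjE) (erule spec)

lemma q0_in: "q0 x \<in> V0" and q_in: "q i x \<in> V i" and q_sum: "x = q0 x + (\<Sum>i\<in>UNIV. q i x)"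
  using theI'[OF component_ex1[of x]] unfolding component_def by blast+

lemma component_eqI:
  assumes "fst w \<in> V0" "\<And>i. snd w $ i \<in> V i" "x = fst w + (\<Sum>i\<in>UNIV. snd w $ i)"
  shows "component V0 V x = w"
  unfolding component_def by (rule the1_equality[OF component_ex1]) (use assms in blast)

lemma linear_component: "linear (component V0 V)"
proof (rule linearI)
  fix x y r
  show "component V0 V (x + y) = component V0 V x + component V0 V y"
  proof (rule component_eqI)
    have "x + y = (q0 x + (\<Sum>i\<in>UNIV. q i x)) + (q0 y + (\<Sum>i\<in>UNIV. q i y))"
      using q_sum by metis
    then show "x + y = fst (component V0 V x + component V0 V y)
        + (\<Sum>i\<in>UNIV. snd (component V0 V x + component V0 V y) $ i)"
      by (simp add: sum.distrib)
  qed (auto intro: subspace_add sub0 sub q0_in q_in)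
  show "component V0 V (r *\<^sub>R x) = r *\<^sub>R component V0 V x"
  proof (rule component_eqI)
    have "r *\<^sub>R x = r *\<^sub>R (q0 x + (\<Sum>i\<in>UNIV. q i x))"
      using q_sum by metis
    then show "r *\<^sub>R x = fst (r *\<^sub>R component V0 V x) + (\<Sum>i\<in>UNIV. snd (r *\<^sub>R component V0 V x) $ i)"
      by (simp add: scaleR_right_distrib scaleR_right.sum)
  qed (auto intro: subspace_scale sub0 sub q0_in q_in)
qed

lemma linear_q: "linear (q i)"
  using linear_compose[OF linear_component linear_snd_nth] by (simp add: o_def)

lemma q_base: "x \<in> V0 \<Longrightarrow> q i x = 0"
  using component_eqI[of "(x, 0)" x] by (simp add: subspace_0[OF sub])

lemma q_fibre: "x \<in> V j \<Longrightarrow> q i x = (if i = j then x else 0)"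
  using component_eqI[of "(0, axis j x)" x]
  by (simp add: axis_def subspace_0[OF sub] subspace_0[OF sub0])

lemma B_q:
  assumes "v \<in> V i"
  shows "B (q i x) v = B x v"
proof -
  have "B x v = B (q0 x + (\<Sum>j\<in>UNIV. q j x)) v" using q_sum by metis
  also have "\<dots> = (\<Sum>j\<in>UNIV. B (q j x) v)"
    using orth0[OF q0_in assms] by (simp add: B.add_left B.sum_left)
  also have "\<dots> = (\<Sum>j\<in>UNIV. if j = i then B (q i x) v else 0)"
    using orth[OF _ q_in assms] by (intro sum.cong) auto
  finally show ?thesis by simp
qed

lemma B_a_fibre: "v \<in> V i \<Longrightarrow> B (a j) v = 0" "v \<in> V i \<Longrightarrow> B v (a j) = 0"
  using orth0[OF a_in] sym by metis+

lemma Ck_on_B: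
  assumes "open U" "Ck_on n f U" "Ck_on n g U"
  shows "Ck_on n (\<lambda>x. B (f x) (g x)) U"
  by (rule Ck_on_bilinear[OF bilin assms])

lemma Ck_on_warped_map: "Ck_on n (warped_map (warp B a c) pbar) UNIV"
proof -
  have "Ck_on n (\<lambda>z. fst z + (\<Sum>i\<in>UNIV. B (a i) (fst z - c) *\<^sub>R (snd z $ i - pbar))) UNIV"
    by (intro Ck_on_add Ck_on_sum Ck_on_bounded_bilinear[OF bounded_bilinear_scaleR] Ck_on_B
        Ck_on_const Ck_on_fst_diff Ck_on_snd_diff Ck_on_linear[OF linear_fst] Ck_on_ident open_UNIV)
  then show ?thesis by (simp add: warped_map_def[abs_def] warp_def)
qed

lemma has_derivative_warped_map:
  "(warped_map (warp B a c) pbar has_derivative warped_deriv B a c pbar z) (at z)"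
proof -
  have 1: "((\<lambda>z. snd z $ i - pbar) has_derivative (\<lambda>u. snd u $ i)) (at z)" for i
    using linear_imp_has_derivative[OF linear_snd_nth] by (auto intro!: derivative_eq_intros)
  have 2: "((\<lambda>z. B (a i) (fst z - c)) has_derivative (\<lambda>u. B (a i) (fst u))) (at z)" for i
    by (rule bounded_linear.has_derivative[OF B.bounded_linear_right]) (auto intro!: derivative_eq_intros)
  have "((\<lambda>z. fst z + (\<Sum>i\<in>UNIV. B (a i) (fst z - c) *\<^sub>R (snd z $ i - pbar))) has_derivative
      (\<lambda>u. fst u + (\<Sum>i\<in>UNIV. B (a i) (fst z - c) *\<^sub>R (snd u $ i)
        + B (a i) (fst u) *\<^sub>R (snd z $ i - pbar)))) (at z)"
    by (intro has_derivative_add has_derivative_sum has_derivative_scaleR 1 2 has_derivative_fst has_derivative_ident)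
  then show ?thesis
    by (simp add: warped_map_def[abs_def] warp_def warped_deriv_def[abs_def] add.commute)
qed

abbreviation "wmetric c \<equiv> warped_metric (\<lambda>_. B) (\<lambda>_ _. B) (warp B a c)"

lemma bilinear_metric: "bilinear (wmetric c z)"
  by (auto intro!: linearI simp: bilinear_def warped_metric_def B.add_left B.add_right B.scaleR_left
      B.scaleR_right algebra_simps sum.distrib sum_distrib_left)

lemma metric_commute: "wmetric c z u v = wmetric c z v u"
  by (simp add: warped_metric_def sym)

lemma Ck_on_metric: "Ck_on n (\<lambda>z. wmetric c z u v) UNIV"
proof -
  have "Ck_on n (\<lambda>z. B (fst u) (fst v) + (\<Sum>i\<in>UNIV. B (a i) (fst z - c) * B (a i) (fst z - c)
      * B (snd u $ i) (snd v $ i))) UNIV"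
    by (intro Ck_on_add Ck_on_sum Ck_on_bounded_bilinear[OF bounded_bilinear_mult] Ck_on_B
        Ck_on_const Ck_on_fst_diff open_UNIV)
  then show ?thesis by (simp add: warped_metric_def warp_def power2_eq_square)
qed

lemma isometry_warped_map:
  assumes "open Y" "\<And>n. Ck_on n h Y"
    and "\<And>z. z \<in> M \<Longrightarrow> warped_map (warp B a c) pbar z \<in> Y \<and> h (warped_map (warp B a c) pbar z) = z"
    and "\<And>y. y \<in> Y \<Longrightarrow> h y \<in> M \<and> warped_map (warp B a c) pbar (h y) = y"
    and "\<And>z u v. z \<in> M \<Longrightarrow> u \<in> tangent_space M z \<Longrightarrow> v \<in> tangent_space M z \<Longrightarrow>
      B (warped_deriv B a c pbar z u) (warped_deriv B a c pbar z v) = wmetric c z u v"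
  shows "isometry_onto M (wmetric c) Y (\<lambda>_. B) (warped_map (warp B a c) pbar)"
  by (rule isometry_onto_openI[OF assms(1) Ck_on_warped_map assms(2-4) form bilinear_metric
        metric_commute Ck_on_metric has_derivative_warped_map assms(5)])

text \<open>As \<open>pbar - c\<close> lies in \<open>V0\<close>, the translates of
  \<open>V0\<close> through \<open>c\<close> and through \<open>pbar\<close> coincide; finitely many
  strict inequalities cut an open set out of this plane.\<close>

lemma openin_base_set:
  assumes "pbar - c \<in> V0"
  shows "openin (top_of_set ((+) pbar ` V0)) (base_set B V0 a c)"
proof -
  have "c + p \<in> (+) pbar ` V0 \<longleftrightarrow> p \<in> V0" for p
  proof -
    have "c + p \<in> (+) pbar ` V0 \<longleftrightarrow> p - (pbar - c) \<in> V0"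
      by (auto simp: image_iff algebra_simps intro: bexI[of _ "p - (pbar - c)"])
    then show ?thesis
      using subspace_add[OF sub0 _ assms, of "p - (pbar - c)"] subspace_diff[OF sub0 _ assms, of p] by auto
  qed
  then have "base_set B V0 a c = (+) pbar ` V0 \<inter> (\<Inter>i. {x. B (a i) (x - c) > 0})"
    unfolding base_set_def by (force intro: exI[of _ "_ - c"])
  moreover have "open (\<Inter>i. {x. B (a i) (x - c) > 0})"
    by (intro open_INT ballI open_Collect_less continuous_intros B.continuous_on) auto
  ultimately show ?thesis by (auto simp: openin_open)
qed

lemma warp_pos: "p \<in> base_set B V0 a c \<Longrightarrow> 0 < warp B a c i p"
  by (auto simp: base_set_def warp_def)

lemma warp_eq: "B (a i) (pbar - c) = 1 \<Longrightarrow> warp B a c i p = 1 + B (a i) (p - pbar)"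
  by (simp add: warp_def B.diff_right)

end

section \<open>The non-null case\<close>

locale nonnull_decomposed_space = decomposed_space +
  assumes a_nonnull: "\<And>i. B (a i) (a i) \<noteq> 0"
begin

abbreviation "\<kappa> i \<equiv> B (a i) (a i)"
definition "c = pbar - (\<Sum>i\<in>UNIV. (1 / \<kappa> i) *\<^sub>R a i)"
abbreviation "W i \<equiv> line_plus (a i) (V i)"

text \<open>An explicit formula for the projection onto \<open>W i\<close>, possible because
  \<open>a i\<close> is orthogonal to \<open>V i\<close> and not null; \<open>orth_proj_eq\<close>
  matches it with the abstract one.\<close>

definition P :: "'b \<Rightarrow> 'a \<Rightarrow> 'a" where
  "P i x = (B (a i) x / \<kappa> i) *\<^sub>R a i + q i x"

lemma P_in: "P i x \<in> W i"
  unfolding P_def line_plus_def using q_in by blast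

lemma linear_P: "linear (P i)"
  by (rule linearI)
    (simp_all add: P_def linear_add[OF linear_q] linear_cmul[OF linear_q] B.add_right B.scaleR_right
      add_divide_distrib algebra_simps)

lemma a_in_W: "a i \<in> W i"
  unfolding line_plus_def using subspace_0[OF sub] by (force intro: exI[of _ 1] exI[of _ 0])

lemma subspace_W: "subspace (W i)"
  by (intro subspace_line_plus sub)

lemma P_W: "w \<in> W i \<Longrightarrow> P i w = w"
  using a_nonnull[of i]
  by (auto simp: line_plus_def P_def B.add_right B.scaleR_right B_a_fibre
      linear_add[OF linear_q] linear_cmul[OF linear_q] q_base[OF a_in] q_fibre)

lemma P_W_other: "i \<noteq> j \<Longrightarrow> w \<in> W j \<Longrightarrow> P i w = 0"
  by (auto simp: line_plus_def P_def B.add_right B.scaleR_right B_a_fibre a_orth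
      linear_add[OF linear_q] linear_cmul[OF linear_q] q_base[OF a_in] q_fibre)

lemma P_base: "x \<in> V0 \<Longrightarrow> P i x = (B (a i) x / \<kappa> i) *\<^sub>R a i"
  by (simp add: P_def q_base)

lemma B_P: "w \<in> W i \<Longrightarrow> B (P i x) w = B x w"
  using a_nonnull[of i] sym[of x "a i"] orth0[OF a_in q_in] orth0[OF a_in] B_q
  by (auto simp: line_plus_def P_def B.add_right B.scaleR_right B.add_left B.scaleR_left
      B_a_fibre[OF q_in])

lemma orth_W: "i \<noteq> j \<Longrightarrow> x \<in> W i \<Longrightarrow> y \<in> W j \<Longrightarrow> B x y = 0"
  using B_P[of x i y] sym P_W_other by (simp add: B.zero_left)

lemma orth_proj_eq: "orth_proj B (W i) = P i"
proof
  fix x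
  show "orth_proj B (W i) x = P i x"
    unfolding orth_proj_def
  proof (rule the_equality)
    show "P i x \<in> W i \<and> (\<forall>w\<in>W i. B (x - P i x) w = 0)"
      using P_in B_P by (simp add: B.diff_left)
    fix y assume y: "y \<in> W i \<and> (\<forall>w\<in>W i. B (x - y) w = 0)"
    \<comment> \<open>The difference lies in \<open>W i\<close> and is orthogonal to
      \<open>W i\<close>. Replacing \<open>w\<close> by \<open>P i w\<close> extends the
      orthogonality to the whole space, where \<open>B\<close> is non-degenerate.\<close>
    have "B (y - P i x) w = 0" for w
    proof -
      have "y - P i x \<in> W i" using y P_in subspace_diff[OF subspace_W] by blast
      then have "B (y - P i x) w = B (y - P i x) (P i w)"
        using B_P[of "y - P i x" i w] sym by metis
      also have "\<dots> = B y (P i w) - B x (P i w)"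
        using B_P[OF P_in] by (simp add: B.diff_left)
      also have "\<dots> = 0" using y P_in by (simp add: B.diff_left)
      finally show ?thesis .
    qed
    then show "y = P i x" using nondeg[of "y - P i x"] by simp
  qed
qed

lemma B_a_P: "B (a i) (P j x) = (if i = j then B (a i) x else 0)"
  using B_P[OF a_in_W, of i x] P_in a_in_W orth_W sym by metis

text \<open>Only the \<open>i\<close>-th summand of \<open>pbar - c\<close> pairs with
  \<open>a i\<close>, and its coefficient normalises the pairing.\<close>

lemma pbar_c: "pbar - c \<in> V0" "B (a i) (pbar - c) = 1"
proof -
  show "pbar - c \<in> V0"
    by (auto simp: c_def intro!: subspace_sum subspace_scale sub0 a_in)
  have "B (a i) ((1 / \<kappa> j) *\<^sub>R a j) = (if j = i then 1 else 0)" for j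
    using a_orth[of i j] a_nonnull[of i] by (auto simp: B.scaleR_right)
  then have "B (a i) (\<Sum>j\<in>UNIV. (1 / \<kappa> j) *\<^sub>R a j) = 1"
    by (simp only: B.sum_right) simp
  then show "B (a i) (pbar - c) = 1" by (simp add: c_def)
qed

section \<open>The carrier, the components of its image and the inverse map\<close>

abbreviation "M \<equiv> warped_carrier (base_set B V0 a c) (\<lambda>i. spherical B pbar (V i) (a i))"
text \<open>The centre of the \<open>i\<close>-th quadric within \<open>pbar + W i\<close>. It
  differs from \<open>c\<close> by multiples of the other \<open>a j\<close>, a vector orthogonal to
  \<open>W i\<close>.\<close>

definition "m i = pbar - (1 / \<kappa> i) *\<^sub>R a i"
abbreviation "\<psi> \<equiv> warped_map (warp B a c) pbar"

lemma M_iff: "z \<in> M \<longleftrightarrow> fst z - c \<in> V0 \<and>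
    (\<forall>i. B (a i) (fst z - c) > 0 \<and> snd z $ i - m i \<in> W i \<and>
      B (snd z $ i - m i) (snd z $ i - m i) = 1 / \<kappa> i)"
proof -
  have 1: "x \<in> spherical B pbar (V i) (a i) \<longleftrightarrow> x - m i \<in> W i \<and> B (x - m i) (x - m i) = 1 / \<kappa> i" for x i
    using a_nonnull[of i] by (auto simp: spherical_def m_def intro: exI[of _ "x - m i"])
  have 2: "x \<in> base_set B V0 a c \<longleftrightarrow> x - c \<in> V0 \<and> (\<forall>i. B (a i) (x - c) > 0)" for x
    unfolding base_set_def by (auto intro: exI[of _ "x - c"])
  show ?thesis unfolding warped_carrier_def 1 2 by blast
qed

text \<open>Since \<open>snd z $ i - pbar\<close> is \<open>snd z $ i - m i\<close> minus
  \<open>a i / \<kappa> i\<close>, the \<open>a i\<close>-parts of the base point are traded for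
  vectors of \<open>W i\<close>; what remains of \<open>fst z - c\<close> is orthogonal to every
  \<open>a i\<close>.\<close>

lemma warped_map_eq:
  assumes "z \<in> M"
  shows "P i (\<psi> z - c) = B (a i) (fst z - c) *\<^sub>R (snd z $ i - m i)"
    and "\<psi> z - c = fst z - c - (\<Sum>i\<in>UNIV. (B (a i) (fst z - c) / \<kappa> i) *\<^sub>R a i) +
      (\<Sum>i\<in>UNIV. B (a i) (fst z - c) *\<^sub>R (snd z $ i - m i))"
proof -
  let ?e = "fst z - c" and ?w = "\<lambda>i. snd z $ i - m i"
  have e: "?e \<in> V0" and w: "?w i \<in> W i" for i using assms M_iff by blast+
  have eq: "\<psi> z - c = ?e + (\<Sum>i\<in>UNIV. B (a i) ?e *\<^sub>R (?w i - (1 / \<kappa> i) *\<^sub>R a i))"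
    by (simp add: warped_map_def warp_def m_def)
  then show "\<psi> z - c = ?e - (\<Sum>i\<in>UNIV. (B (a i) ?e / \<kappa> i) *\<^sub>R a i) + (\<Sum>i\<in>UNIV. B (a i) ?e *\<^sub>R ?w i)"
    by (simp only: scaleR_right_diff_distrib sum_subtractf) simp
  have "P i (?w j - (1 / \<kappa> j) *\<^sub>R a j) = (if j = i then ?w i - (1 / \<kappa> i) *\<^sub>R a i else 0)" for j
  proof -
    have "?w j - (1 / \<kappa> j) *\<^sub>R a j \<in> W j"
      by (intro subspace_diff subspace_scale subspace_W w a_in_W)
    from P_W[OF this] P_W_other[OF _ this, of i] show ?thesis by (cases "j = i") auto
  qed
  then have "P i (\<psi> z - c) = P i ?e + (\<Sum>j\<in>UNIV. if j = i then B (a i) ?e *\<^sub>R (?w i - (1 / \<kappa> i) *\<^sub>R a i) else 0)"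
    unfolding eq linear_add[OF linear_P] linear_sum[OF linear_P] linear_cmul[OF linear_P]
    by (intro arg_cong2[where f = "(+)"] sum.cong) auto
  \<comment> \<open>The projection of the base part cancels the shift by
    \<open>a i / \<kappa> i\<close>.\<close>
  then show "P i (\<psi> z - c) = B (a i) ?e *\<^sub>R ?w i"
    by (simp only: P_base[OF e]) (simp add: scaleR_right_diff_distrib)
qed

text \<open>At points of the image this is the square of the warping function. The factor
  \<open>\<kappa> i\<close> turns the sign condition on the projection into positivity, whatever the
  sign of \<open>\<kappa> i\<close>.\<close>

definition scale :: "'b \<Rightarrow> 'a \<Rightarrow> real" where
  "scale i y = \<kappa> i * B (P i (y - c)) (P i (y - c))"

text \<open>With \<open>r\<close> the positive root of \<open>scale i y\<close>, the base point has
  each \<open>P i (y - c)\<close> replaced by the multiple of \<open>a i\<close> on which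
  \<open>B (a i)\<close> takes the value \<open>r\<close>; the fibre point is
  \<open>P i (y - c)\<close> divided by \<open>r\<close>, moved to the centre
  \<open>m i\<close>.\<close>

definition unwarp :: "'a \<Rightarrow> 'a \<times> ('a ^ 'b)" where
  "unwarp y = (y + (\<Sum>i\<in>UNIV. (scale i y powr (1/2)) *\<^sub>R ((1 / \<kappa> i) *\<^sub>R a i) - P i (y - c)),
     \<chi> i. m i + (scale i y powr (- (1/2))) *\<^sub>R P i (y - c))"

abbreviation "Y \<equiv> {y. \<forall>i. 0 < scale i y}"

lemma Ck_on_P: "open U \<Longrightarrow> Ck_on n (\<lambda>y. P i (y - c)) U"
  by (intro Ck_on_linear[OF linear_P] Ck_on_diff_const Ck_on_ident)

lemma Ck_on_scale: "open U \<Longrightarrow> Ck_on n (scale i) U"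
  unfolding scale_def[abs_def]
  by (intro Ck_on_bounded_bilinear[OF bounded_bilinear_mult] Ck_on_B Ck_on_const Ck_on_P)

lemma open_Y: "open Y"
proof -
  have "continuous_on UNIV (scale i)" for i
    using Ck_on_scale[OF open_UNIV, of 0] by simp
  then have "open (\<Inter>i. {y. 0 < scale i y})"
    by (intro open_INT ballI open_Collect_less continuous_on_const) auto
  moreover have "Y = (\<Inter>i. {y. 0 < scale i y})" by auto
  ultimately show ?thesis by simp
qed

lemma Ck_on_unwarp: "Ck_on n unwarp Y"
  unfolding unwarp_def[abs_def]
proof (intro Ck_on_Pair Ck_on_vec_lambda Ck_on_add Ck_on_sum Ck_on_ident Ck_on_const open_Y)
  fix i
  have "Ck_on n (\<lambda>y. (scale i y powr (1/2)) *\<^sub>R ((1 / \<kappa> i) *\<^sub>R a i) + (- 1) *\<^sub>R P i (y - c)) Y"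
    by (intro Ck_on_add Ck_on_bounded_bilinear[OF bounded_bilinear_scaleR] Ck_on_powr Ck_on_scale Ck_on_P
        Ck_on_const open_Y) auto
  then show "Ck_on n (\<lambda>y. (scale i y powr (1/2)) *\<^sub>R ((1 / \<kappa> i) *\<^sub>R a i) - P i (y - c)) Y"
    by simp
  show "Ck_on n (\<lambda>y. (scale i y powr (- (1/2))) *\<^sub>R P i (y - c)) Y"
    by (intro Ck_on_bounded_bilinear[OF bounded_bilinear_scaleR] Ck_on_powr Ck_on_scale Ck_on_P open_Y) auto
qed

lemma unwarp_\<psi>:
  assumes "z \<in> M"
  shows "\<psi> z \<in> Y \<and> unwarp (\<psi> z) = z"
proof -
  let ?r = "\<lambda>i. B (a i) (fst z - c)" and ?w = "\<lambda>i. snd z $ i - m i"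
  note Pz = warped_map_eq(1)[OF assms]
  have r: "0 < ?r i" and w2: "B (?w i) (?w i) = 1 / \<kappa> i" for i using assms M_iff by blast+
  have s: "scale i (\<psi> z) = (?r i)\<^sup>2" for i
    unfolding scale_def Pz B.scaleR_left B.scaleR_right w2 using a_nonnull[of i]
    by (simp add: power2_eq_square)
  have p: "scale i (\<psi> z) powr (1/2) = ?r i" "scale i (\<psi> z) powr (- (1/2)) = 1 / ?r i" for i
    using r[of i] unfolding powr_minus_divide powr_half_sqrt s by auto
  have "\<psi> z + (\<Sum>i\<in>UNIV. ?r i *\<^sub>R ((1 / \<kappa> i) *\<^sub>R a i) - ?r i *\<^sub>R ?w i) = fst z"
  proof -
    have "\<psi> z = c + (\<psi> z - c)" by simp
    then show ?thesis
      unfolding warped_map_eq(2)[OF assms] by (simp only: sum_subtractf) (simp add: algebra_simps)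
  qed
  moreover have "(\<chi> i. m i + (1 / ?r i) *\<^sub>R (?r i *\<^sub>R ?w i)) = snd z"
    using r by (simp add: vec_eq_iff less_imp_neq[THEN not_sym])
  ultimately have "unwarp (\<psi> z) = z"
    unfolding unwarp_def Pz p by (metis prod.collapse)
  then show ?thesis using s r by (simp add: zero_less_power less_imp_neq[THEN not_sym])
qed

lemma \<psi>_unwarp:
  assumes "y \<in> Y"
  shows "unwarp y \<in> M \<and> \<psi> (unwarp y) = y"
proof -
  let ?p = "y - c" and ?r = "\<lambda>i. scale i y powr (1/2)"
  have s: "0 < scale i y" for i using assms by simp
  have r: "0 < ?r i" and rr: "?r i * ?r i = scale i y" for i
    using s[of i] by (auto simp: powr_half_sqrt)
  have r': "scale i y powr (- (1/2)) = 1 / ?r i" for i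
    by (simp add: powr_minus_divide)
  have fst: "fst (unwarp y) - c = ?p + (\<Sum>i\<in>UNIV. ?r i *\<^sub>R ((1 / \<kappa> i) *\<^sub>R a i) - P i ?p)"
    by (simp add: unwarp_def)
  have snd: "snd (unwarp y) $ i - m i = (1 / ?r i) *\<^sub>R P i ?p" for i
    by (simp add: unwarp_def r')
  \<comment> \<open>Only the summand \<open>i = j\<close> contributes, exchanging
    \<open>B (a j) ?p\<close> for \<open>?r j\<close>.\<close>
  have B: "B (a j) (fst (unwarp y) - c) = ?r j" for j
  proof -
    have "B (a j) (?r i *\<^sub>R ((1 / \<kappa> i) *\<^sub>R a i) - P i ?p) = (if i = j then ?r j - B (a j) ?p else 0)" for i
      using a_nonnull[of i] a_orth[of j i]
      by (cases "i = j") (simp_all add: B.diff_right B.scaleR_right B_a_P)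
    then show ?thesis unfolding fst B.add_right B.sum_right by simp
  qed
  \<comment> \<open>Subtracting the projections removes all \<open>V i\<close>-components of
    \<open>?p\<close>; \<open>q0 ?p\<close> and multiples of the \<open>a i\<close> remain.\<close>
  have "fst (unwarp y) - c = q0 ?p + (\<Sum>i\<in>UNIV. (?r i * (1 / \<kappa> i) - B (a i) ?p / \<kappa> i) *\<^sub>R a i)"
  proof -
    have "fst (unwarp y) - c = (q0 ?p + (\<Sum>i\<in>UNIV. q i ?p)) + (\<Sum>i\<in>UNIV. ?r i *\<^sub>R ((1 / \<kappa> i) *\<^sub>R a i) - P i ?p)"
      unfolding fst using q_sum by metis
    then show ?thesis
      by (simp add: P_def add.assoc sum.distrib[symmetric] algebra_simps)
  qed
  also have "\<dots> \<in> V0"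
    by (intro subspace_add subspace_sum subspace_scale sub0 q0_in a_in)
  finally have "fst (unwarp y) - c \<in> V0" .
  moreover have "B ((1 / ?r i) *\<^sub>R P i ?p) ((1 / ?r i) *\<^sub>R P i ?p) = 1 / \<kappa> i" for i
  proof -
    have "B ((1 / ?r i) *\<^sub>R P i ?p) ((1 / ?r i) *\<^sub>R P i ?p) = B (P i ?p) (P i ?p) / (?r i * ?r i)"
      by (simp add: B.scaleR_left B.scaleR_right)
    moreover have "B (P i ?p) (P i ?p) \<noteq> 0"
      using s[of i] by (auto simp: scale_def)
    ultimately show ?thesis
      unfolding rr unfolding scale_def using a_nonnull[of i] by simp
  qed
  ultimately have M: "unwarp y \<in> M"
    unfolding M_iff snd B using r P_in subspace_scale[OF subspace_W] by blast
  have cancel: "t *\<^sub>R ((1 / t) *\<^sub>R x) = x" if "0 < t" for t and x :: 'a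
    using that by simp
  have "\<psi> (unwarp y) - c = ?p"
    unfolding warped_map_eq(2)[OF M] B snd cancel[OF r] unfolding fst
    by (simp add: sum_subtractf)
  then show ?thesis using M by simp
qed

text \<open>Pythagoras for the mutually orthogonal \<open>W i\<close> and their common orthogonal
  complement.\<close>

lemma B_orth_sum:
  assumes "\<And>i w. w \<in> W i \<Longrightarrow> B H w = 0" "\<And>i w. w \<in> W i \<Longrightarrow> B H' w = 0"
    and "\<And>i. X i \<in> W i" "\<And>i. X' i \<in> W i"
  shows "B (H + (\<Sum>i\<in>UNIV. X i)) (H' + (\<Sum>i\<in>UNIV. X' i)) = B H H' + (\<Sum>i\<in>UNIV. B (X i) (X' i))"
proof -
  have "B H (\<Sum>i\<in>UNIV. X' i) = 0" "B (\<Sum>i\<in>UNIV. X i) H' = 0"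
    using assms(1)[OF assms(4)] assms(2)[OF assms(3)] sym[of _ H'] by (simp_all add: B.sum_left B.sum_right)
  moreover have "B (X i) (\<Sum>j\<in>UNIV. X' j) = B (X i) (X' i)" for i
  proof -
    have "(\<Sum>j\<in>UNIV. B (X i) (X' j)) = (\<Sum>j\<in>UNIV. if j = i then B (X i) (X' i) else 0)"
      using orth_W[OF not_sym assms(3,4)] by (intro sum.cong) auto
    then show ?thesis by (simp add: B.sum_right)
  qed
  ultimately show ?thesis by (simp add: B.add_left B.add_right B.sum_left)
qed

lemma tangent_M:
  assumes "u \<in> tangent_space M z"
  shows "fst u \<in> V0" "snd u $ i \<in> W i" "B (snd z $ i - m i) (snd u $ i) = 0"
proof -
  show "fst u \<in> V0"
    by (rule tangent_space_linear_subspace[OF assms linear_fst sub0]) (use M_iff in blast)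
  show "snd u $ i \<in> W i"
    by (rule tangent_space_linear_subspace[OF assms linear_snd_nth subspace_W]) (use M_iff in blast)
  show "B (snd z $ i - m i) (snd u $ i) = 0"
    by (rule tangent_space_quadric[OF assms linear_snd_nth bilin sym]) (use M_iff in blast)
qed

text \<open>The radius vector has square \<open>1 / \<kappa> i\<close> and is orthogonal to the
  fibre velocity, so the \<open>W i\<close>-part contributes a radial term and the warped fibre term
  without mixed terms. The radial terms restore what \<open>H\<close> has lost from the base
  velocity.\<close>

lemma metric_\<psi>:
  assumes z: "z \<in> M" and u: "u \<in> tangent_space M z" and v: "v \<in> tangent_space M z"
  shows "B (warped_deriv B a c pbar z u) (warped_deriv B a c pbar z v) = wmetric c z u v"
proof -
  let ?r = "\<lambda>i. B (a i) (fst z - c)" and ?w = "\<lambda>i. snd z $ i - m i"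
  \<comment> \<open>\<open>H u\<close> is the part of \<open>fst u\<close> orthogonal to all
    \<open>a i\<close>; \<open>X u i\<close> is the derivative of warping function times radius
    vector.\<close>
  define H where "H u = fst u - (\<Sum>i\<in>UNIV. (B (a i) (fst u) / \<kappa> i) *\<^sub>R a i)" for u :: "'a \<times> ('a ^ 'b)"
  define X where "X u i = B (a i) (fst u) *\<^sub>R ?w i + ?r i *\<^sub>R (snd u $ i)" for u i
  have w: "?w i \<in> W i" "B (?w i) (?w i) = 1 / \<kappa> i" for i using z M_iff by blast+
  have dec: "warped_deriv B a c pbar z u = H u + (\<Sum>i\<in>UNIV. X u i)" for u
    by (simp add: warped_deriv_def H_def X_def m_def sum_subtractf sum.distrib algebra_simps)
  have X: "X u i \<in> W i" if "u \<in> tangent_space M z" for u i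
    unfolding X_def using w tangent_M[OF that] by (intro subspace_add subspace_scale subspace_W)
  have Ha: "B (a j) (H u) = 0" for u j
  proof -
    have "B (a j) ((B (a i) (fst u) / \<kappa> i) *\<^sub>R a i) = (if i = j then B (a j) (fst u) else 0)" for i
      using a_nonnull a_orth[of j i] by (simp add: B.scaleR_right)
    then show ?thesis by (simp add: H_def B.diff_right B.sum_right)
  qed
  have HV: "H u \<in> V0" if "u \<in> tangent_space M z" for u
    unfolding H_def using tangent_M(1)[OF that]
    by (intro subspace_diff subspace_sum subspace_scale sub0 a_in)
  have HW: "B (H u) w = 0" if "u \<in> tangent_space M z" "w \<in> W i" for u w i
    using that(2) Ha[of i u] orth0[OF HV[OF that(1)]] sym[of "H u" "a i"]
    by (auto simp: line_plus_def B.add_right B.scaleR_right)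
  \<comment> \<open>The part subtracted from \<open>fst v\<close> consists of multiples of the
    \<open>a i\<close>, to which \<open>H u\<close> is orthogonal.\<close>
  have "B (H u) (H v) = B (H u) (fst v)"
    using Ha sym[of "H u"] by (simp add: H_def[of v] B.diff_right B.sum_right B.scaleR_right)
  also have "\<dots> = B (fst u) (fst v) - (\<Sum>i\<in>UNIV. B (a i) (fst u) * B (a i) (fst v) / \<kappa> i)"
    by (simp add: H_def B.diff_left B.sum_left B.scaleR_left)
  finally have HH: "B (H u) (H v) = B (fst u) (fst v) - (\<Sum>i\<in>UNIV. B (a i) (fst u) * B (a i) (fst v) / \<kappa> i)" .
  have XX: "B (X u i) (X v i) = B (a i) (fst u) * B (a i) (fst v) / \<kappa> i + (?r i)\<^sup>2 * B (snd u $ i) (snd v $ i)" for i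
  proof -
    have "B (?w i) (snd u $ i) = 0" "B (?w i) (snd v $ i) = 0" "B (snd u $ i) (?w i) = 0"
      using tangent_M(3)[OF u, of i] tangent_M(3)[OF v, of i] sym[of "snd u $ i" "?w i"] by simp_all
    then show ?thesis
      unfolding X_def B.add_left B.add_right B.scaleR_left B.scaleR_right w(2)
      by (simp add: power2_eq_square)
  qed
  show ?thesis
    unfolding dec
    by (subst B_orth_sum) (use HW X u v HH XX in \<open>auto simp: warped_metric_def warp_def sum.distrib\<close>)
qed

section \<open>The image in the non-null case and its density\<close>

lemma image_eq: "{c + p | p. \<forall>i. sgn (B (orth_proj B (W i) p) (orth_proj B (W i) p)) = sgn (\<kappa> i)} = Y"
proof -
  have "sgn (B (P i p) (P i p)) = sgn (\<kappa> i) \<longleftrightarrow> 0 < \<kappa> i * B (P i p) (P i p)" for i p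
    using a_nonnull[of i] by (auto simp: sgn_if zero_less_mult_iff)
  then show ?thesis
    unfolding orth_proj_eq scale_def by (auto intro: exI[of _ "_ - c"])
qed

lemma isometry: "isometry_onto M (wmetric c) Y (\<lambda>_. B) \<psi>"
  by (rule isometry_warped_map[OF open_Y Ck_on_unwarp unwarp_\<psi> \<psi>_unwarp metric_\<psi>])

lemma \<psi>_image: "\<psi> ` M = Y"
  using unwarp_\<psi> \<psi>_unwarp by (force simp: image_iff)

text \<open>On a definite \<open>W i\<close> every non-zero square has the sign of
  \<open>\<kappa> i\<close>, because \<open>a i\<close> lies in \<open>W i\<close>. So
  \<open>Y\<close> is where no \<open>P i (y - c)\<close> vanishes, and a small move along the sum
  of the \<open>a i\<close> makes all of them non-zero at once.\<close>

lemma dense_if_definite: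
  assumes "\<And>i. definite_on (W i) B"
  shows "closure Y = UNIV"
proof -
  have "y \<in> closure Y" for y
  proof -
    let ?g = "\<lambda>t::real. y + t *\<^sub>R (\<Sum>i\<in>UNIV. a i)"
    have Pg: "P i (?g t - c) = P i (y - c) + t *\<^sub>R a i" for i t
    proof -
      have "P i (a j) = (if j = i then a i else 0)" for j
        using P_W[OF a_in_W] P_W_other[OF not_sym a_in_W] by auto
      then have "P i (\<Sum>j\<in>UNIV. a j) = a i" by (simp add: linear_sum[OF linear_P])
      moreover have "?g t - c = (y - c) + t *\<^sub>R (\<Sum>i\<in>UNIV. a i)" by simp
      ultimately show ?thesis by (simp only: linear_add[OF linear_P] linear_cmul[OF linear_P])
    qed
    have a0: "a i \<noteq> 0" for i using a_nonnull[of i] by (auto simp: B.zero_left)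
    have pos: "0 < \<kappa> i * B w w" if "w \<in> W i" "w \<noteq> 0" for w i
      using assms[of i] a_in_W[of i] a0[of i] that unfolding definite_on_def
      by (auto intro: mult_pos_pos mult_neg_neg)
    \<comment> \<open>A vanishing projection becomes \<open>t *\<^sub>R a i\<close>; a non-zero one
      stays non-zero for small \<open>t\<close> by continuity.\<close>
    have "eventually (\<lambda>t. P i (?g t - c) \<noteq> 0) (at 0)" for i
    proof (cases "P i (y - c) = 0")
      case True
      then show ?thesis using a0[of i] by (simp only: Pg) (auto simp: eventually_at_filter)
    next
      case False
      have "((\<lambda>t. P i (y - c) + t *\<^sub>R a i) \<longlongrightarrow> P i (y - c) + 0 *\<^sub>R a i) (at 0)"
        by (intro tendsto_intros)
      then show ?thesis using False by (simp only: Pg) (auto dest: tendsto_imp_eventually_ne)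
    qed
    then have "eventually (\<lambda>t. \<forall>i. P i (?g t - c) \<noteq> 0) (at 0)"
      by (simp add: eventually_all_finite)
    then have "eventually (\<lambda>t. ?g t \<in> closure Y) (at 0)"
      by eventually_elim (use pos P_in closure_subset in \<open>force simp: scale_def\<close>)
    moreover have "(?g \<longlongrightarrow> y + 0 *\<^sub>R (\<Sum>i\<in>UNIV. a i)) (at 0)"
      by (intro tendsto_intros)
    ultimately show ?thesis
      using Lim_in_closed_set[of "closure Y" ?g "at 0"] by simp
  qed
  then show ?thesis by auto
qed

text \<open>A \<open>W i\<close> that is not definite contains \<open>w\<close> with
  \<open>\<kappa> i * B w w < 0\<close>. Then \<open>scale i\<close> is negative at
  \<open>c + w\<close>, but it is non-negative on the closure of \<open>Y\<close>.\<close>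

lemma definite_if_dense:
  assumes "closure Y = UNIV"
  shows "definite_on (W i) B"
proof (rule ccontr)
  assume nd: "\<not> definite_on (W i) B"
  have "\<exists>w\<in>W i. \<kappa> i * B w w < 0"
  proof -
    \<comment> \<open>Failure of definiteness with the sign of \<open>\<kappa> i\<close> gives only
      the weak inequality.\<close>
    obtain w where w: "w \<in> W i" "w \<noteq> 0" "\<kappa> i * B w w \<le> 0"
    proof (cases "\<kappa> i > 0")
      case True
      then show ?thesis using that nd unfolding definite_on_def
        by (meson linorder_not_less mult_nonneg_nonpos less_imp_le)
    next
      case False
      then show ?thesis using that nd unfolding definite_on_def
        by (meson linorder_not_less mult_nonpos_nonneg)
    qed
    show ?thesis
    proof (cases "\<kappa> i * B w w = 0")
      case False
      then show ?thesis using w by (intro bexI[of _ w]) linarith+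
    next
      case True
      then have ww: "B w w = 0" using a_nonnull by simp
      \<comment> \<open>A null \<open>w\<close> has to be perturbed. Non-degeneracy supplies a
        vector not orthogonal to it, and \<open>P i\<close> moves that vector into
        \<open>W i\<close> without changing the pairing with \<open>w\<close>.\<close>
      obtain v where "B w v \<noteq> 0" using nondeg w(2) by blast
      then have nz: "B w (P i v) \<noteq> 0" using B_P[OF w(1), of v] sym by metis
      let ?v = "P i v"
      \<comment> \<open>With this \<open>s\<close> the first-order term of the square along
        \<open>w + (t * s) *\<^sub>R ?v\<close>, times \<open>\<kappa> i\<close>, has a negative
        coefficient.\<close>
      define s where "s = - \<kappa> i * B w ?v"
      have s: "\<kappa> i * (s * B w ?v) < 0"
      proof -
        have "\<kappa> i * (s * B w ?v) = - (\<kappa> i * B w ?v)\<^sup>2" by (simp add: s_def power2_eq_square)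
        then show ?thesis using nz a_nonnull[of i] by simp
      qed
      \<comment> \<open>The square of the perturbed vector times \<open>\<kappa> i\<close>, divided
        by \<open>t\<close>: its limit at \<open>0\<close> is that coefficient.\<close>
      define f where "f t = \<kappa> i * (2 * (s * B w ?v) + t * (s * s * B ?v ?v))" for t
      have "(f \<longlongrightarrow> \<kappa> i * (2 * (s * B w ?v) + 0 * (s * s * B ?v ?v))) (at_right 0)"
        unfolding f_def by (intro tendsto_intros)
      moreover have "\<kappa> i * (2 * (s * B w ?v) + 0 * (s * s * B ?v ?v)) < 0"
        using s by (simp add: mult.left_commute)
      ultimately have "eventually (\<lambda>t. f t < 0) (at_right 0)"
        by (rule order_tendstoD(2))
      then obtain t where t: "t > 0" "f t < 0"
        using eventually_happens'[OF _ eventually_conj[OF _ eventually_at_right_less[of 0]]]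
        by (metis trivial_limit_at_right_real)
      have "\<kappa> i * B (w + (t * s) *\<^sub>R ?v) (w + (t * s) *\<^sub>R ?v) = t * f t"
        using ww sym[of ?v w] by (simp add: f_def B.add_left B.add_right B.scaleR_left B.scaleR_right algebra_simps)
      then have "\<kappa> i * B (w + (t * s) *\<^sub>R ?v) (w + (t * s) *\<^sub>R ?v) < 0"
        using t by (simp add: mult_pos_neg)
      moreover have "w + (t * s) *\<^sub>R ?v \<in> W i"
        using w P_in by (intro subspace_add subspace_scale subspace_W)
      ultimately show ?thesis by blast
    qed
  qed
  then obtain w where w: "w \<in> W i" "\<kappa> i * B w w < 0" by blast
  have "continuous_on UNIV (scale i)"
    using Ck_on_scale[OF open_UNIV, of 0] by simp
  then have "closed {y. 0 \<le> scale i y}"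
    by (intro closed_Collect_le continuous_on_const)
  then have "closure Y \<subseteq> {y. 0 \<le> scale i y}"
    by (intro closure_minimal) (auto intro: less_imp_le)
  then have "0 \<le> scale i (c + w)" using assms by blast
  then show False using w P_W[OF w(1)] by (simp add: scale_def)
qed

end

section \<open>The null case\<close>

text \<open>\<open>a k\<close> and \<open>b\<close> form a hyperbolic pair; naming the sole index
  \<open>k\<close> collapses sums and quantifiers over the index type.\<close>

locale null_decomposed_space = decomposed_space +
  fixes k :: 'b and b :: 'a
  assumes univ: "UNIV = {k}"
    and a_null: "B (a k) (a k) = 0" and b_in: "b \<in> V0" and b_null: "B b b = 0" and a_b: "B (a k) b = 1"
begin

lemma all_k: "(\<forall>i. Q i) \<longleftrightarrow> Q k"
  using univ by (metis UNIV_I singletonD)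

definition "c = pbar - b"
abbreviation "W \<equiv> line_plus (a k) (V k)"
abbreviation "M \<equiv> warped_carrier (base_set B V0 a c) (\<lambda>i. spherical B pbar (V i) (a i))"
abbreviation "\<psi> \<equiv> warped_map (warp B a c) pbar"
abbreviation "Y \<equiv> {y. 0 < B (a k) (y - c)}"

text \<open>The parametrisation of the paraboloid by \<open>V k\<close>, relative to
  \<open>pbar\<close>.\<close>

definition lift :: "'a \<Rightarrow> 'a" where
  "lift v = v - (B v v / 2) *\<^sub>R a k"

lemma pbar_c: "pbar - c \<in> V0" "B (a k) (pbar - c) = 1"
  using b_in a_b by (simp_all add: c_def)

lemma M_iff: "z \<in> M \<longleftrightarrow> fst z - c \<in> V0 \<and> B (a k) (fst z - c) > 0 \<and> (\<exists>v\<in>V k. snd z $ k = pbar + lift v)"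
proof -
  have 2: "x \<in> base_set B V0 a c \<longleftrightarrow> x - c \<in> V0 \<and> B (a k) (x - c) > 0" for x
    unfolding base_set_def all_k by (auto intro: exI[of _ "x - c"])
  show ?thesis unfolding warped_carrier_def all_k mem_Collect_eq 2 spherical_def lift_def
    using a_null by auto
qed

lemma lift_simps:
  assumes "v \<in> V k"
  shows "B (a k) (lift v) = 0" "q k (lift v) = v" "lift v \<in> W"
proof -
  show "B (a k) (lift v) = 0"
    using assms by (simp add: lift_def B.diff_right B.scaleR_right a_null B_a_fibre)
  show "q k (lift v) = v"
    using assms by (simp add: lift_def linear_diff[OF linear_q] linear_cmul[OF linear_q] q_base[OF a_in] q_fibre)
  show "lift v \<in> W"
    using assms unfolding line_plus_def lift_def by (auto intro: exI[of _ "- (B v v / 2)"])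
qed

text \<open>A lift pairs to \<open>0\<close> with \<open>a k\<close> and has
  \<open>V k\<close>-component \<open>v\<close>, so both the warping value and its product with
  \<open>v\<close> can be read off from the image point.\<close>

lemma warped_map_eq:
  assumes "fst z - c \<in> V0" "v \<in> V k" "snd z $ k = pbar + lift v"
  shows "\<psi> z - c = (fst z - c) + B (a k) (fst z - c) *\<^sub>R lift v"
    and "B (a k) (\<psi> z - c) = B (a k) (fst z - c)"
    and "q k (\<psi> z - c) = B (a k) (fst z - c) *\<^sub>R v"
proof -
  show eq: "\<psi> z - c = (fst z - c) + B (a k) (fst z - c) *\<^sub>R lift v"
    using assms by (simp add: warped_map_def warp_def univ)
  show "B (a k) (\<psi> z - c) = B (a k) (fst z - c)"
    unfolding eq B.add_right B.scaleR_right lift_simps[OF assms(2)] by simp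
  show "q k (\<psi> z - c) = B (a k) (fst z - c) *\<^sub>R v"
    unfolding eq linear_add[OF linear_q] linear_cmul[OF linear_q] q_base[OF assms(1)]
      lift_simps[OF assms(2)] by simp
qed

definition fibre_coord :: "'a \<Rightarrow> 'a" where
  "fibre_coord y = (B (a k) (y - c) powr (-1)) *\<^sub>R q k (y - c)"

definition unwarp :: "'a \<Rightarrow> 'a \<times> ('a ^ 'b)" where
  "unwarp y = (y + (- B (a k) (y - c)) *\<^sub>R lift (fibre_coord y), \<chi> i. pbar + lift (fibre_coord y))"

lemma open_Y: "open Y"
  by (intro open_Collect_less continuous_intros B.continuous_on)

lemma Ck_on_lift_fibre_coord: "Ck_on n (\<lambda>y. lift (fibre_coord y)) Y"
proof -
  have fibre_coord: "Ck_on n fibre_coord Y"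
    unfolding fibre_coord_def[abs_def]
    by (intro Ck_on_bounded_bilinear[OF bounded_bilinear_scaleR] Ck_on_powr Ck_on_B
        Ck_on_linear[OF linear_q] Ck_on_diff_const Ck_on_const Ck_on_ident open_Y) auto
  have "Ck_on n (\<lambda>y. fibre_coord y + (- (1/2) * B (fibre_coord y) (fibre_coord y)) *\<^sub>R a k) Y"
    by (intro Ck_on_add Ck_on_bounded_bilinear[OF bounded_bilinear_scaleR]
        Ck_on_bounded_bilinear[OF bounded_bilinear_mult] Ck_on_B Ck_on_const fibre_coord open_Y)
  then show ?thesis by (simp add: lift_def)
qed

lemma Ck_on_unwarp: "Ck_on n unwarp Y"
proof -
  have "Ck_on n (\<lambda>y. (y + ((-1) * B (a k) (y - c)) *\<^sub>R lift (fibre_coord y), \<chi> i::'b. pbar + lift (fibre_coord y))) Y"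
    by (intro Ck_on_Pair Ck_on_vec_lambda Ck_on_add Ck_on_bounded_bilinear[OF bounded_bilinear_scaleR]
        Ck_on_bounded_bilinear[OF bounded_bilinear_mult] Ck_on_lift_fibre_coord Ck_on_B Ck_on_diff_const
        Ck_on_ident Ck_on_const open_Y)
  then show ?thesis by (simp add: unwarp_def[abs_def])
qed

lemma unwarp_\<psi>:
  assumes "z \<in> M"
  shows "\<psi> z \<in> Y \<and> unwarp (\<psi> z) = z"
proof -
  obtain v where e: "fst z - c \<in> V0" and v: "v \<in> V k" "snd z $ k = pbar + lift v"
    and r: "B (a k) (fst z - c) > 0"
    using assms M_iff by blast
  note eq = warped_map_eq[OF e v]
  have fibre_coord: "fibre_coord (\<psi> z) = v"
    using r by (simp add: fibre_coord_def eq(2,3) powr_minus_divide)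
  have "fst (unwarp (\<psi> z)) = c + (\<psi> z - c) + (- B (a k) (fst z - c)) *\<^sub>R lift v"
    by (simp add: unwarp_def fibre_coord eq(2))
  also have "\<dots> = fst z" unfolding eq(1) by simp
  finally have "fst (unwarp (\<psi> z)) = fst z" .
  moreover have "snd (unwarp (\<psi> z)) = snd z"
    using v(2) by (simp add: unwarp_def fibre_coord vec_eq_iff all_k)
  ultimately show ?thesis using r eq(2) by (simp add: prod_eq_iff)
qed

lemma \<psi>_unwarp:
  assumes "y \<in> Y"
  shows "unwarp y \<in> M \<and> \<psi> (unwarp y) = y"
proof -
  let ?p = "y - c" and ?r = "B (a k) (y - c)"
  have r: "0 < ?r" using assms by simp
  have v: "fibre_coord y \<in> V k"
    unfolding fibre_coord_def by (intro subspace_scale sub q_in)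
  have rv: "?r *\<^sub>R fibre_coord y = q k ?p"
    using r by (simp add: fibre_coord_def powr_minus_divide)
  have fst: "fst (unwarp y) - c = ?p - ?r *\<^sub>R lift (fibre_coord y)"
    by (simp add: unwarp_def)
  have snd: "snd (unwarp y) $ k = pbar + lift (fibre_coord y)"
    by (simp add: unwarp_def)
  \<comment> \<open>A lift differs from its parameter by a multiple of \<open>a k\<close>;
    subtracting \<open>?r\<close> times the lift therefore removes the \<open>V k\<close>-component
    and leaves a vector of \<open>V0\<close>.\<close>
  have "?p = q0 ?p + q k ?p" using q_sum[of ?p] by (simp add: univ)
  then have "?p - q k ?p = q0 ?p" by (rule diff_eq_eq[THEN iffD2])
  moreover have "fst (unwarp y) - c = ?p - q k ?p + (?r * (B (fibre_coord y) (fibre_coord y) / 2)) *\<^sub>R a k"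
    unfolding fst rv[symmetric] by (simp add: lift_def scaleR_right_diff_distrib)
  moreover have "q0 ?p + (?r * (B (fibre_coord y) (fibre_coord y) / 2)) *\<^sub>R a k \<in> V0"
    by (intro subspace_add subspace_scale sub0 q0_in a_in)
  ultimately have fst0: "fst (unwarp y) - c \<in> V0" by simp
  have fst1: "B (a k) (fst (unwarp y) - c) = ?r"
    unfolding fst B.diff_right B.scaleR_right lift_simps[OF v] by simp
  have "\<psi> (unwarp y) - c = ?p"
    unfolding warped_map_eq(1)[OF fst0 v snd] fst1 unfolding fst by simp
  then show ?thesis using fst0 fst1 r v snd M_iff by auto
qed

lemma tangent_M:
  assumes u: "u \<in> tangent_space M z" and v: "v \<in> V k" "snd z $ k = pbar + lift v"
  obtains p where "fst u \<in> V0" "p \<in> V k" "snd u $ k = p - B v p *\<^sub>R a k"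
proof -
  have fst: "fst u \<in> V0"
    by (rule tangent_space_linear_subspace[OF u linear_fst sub0]) (use M_iff in blast)
  have "snd u $ k \<in> W"
    by (rule tangent_space_linear_subspace[OF u linear_snd_nth subspace_line_plus[OF sub], where c = pbar])
      (use M_iff lift_simps(3) in auto)
  then obtain t p where p: "p \<in> V k" "snd u $ k = t *\<^sub>R a k + p"
    by (auto simp: line_plus_def)
  \<comment> \<open>Fibre points relative to \<open>c\<close> have the form
    \<open>lift w + b\<close>, which has square zero: the square of \<open>w\<close> cancels against
    the pairing of \<open>b\<close> with \<open>a k\<close>. Thus the paraboloid lies on the null
    cone at \<open>c\<close>, and the quadric condition determines \<open>t\<close>.\<close>
  have "B (snd z $ k - c) (snd u $ k) = 0"
  proof (rule tangent_space_quadric[OF u linear_snd_nth bilin sym, where c = 0])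
    fix y assume "y \<in> M"
    then obtain w where w: "w \<in> V k" "snd y $ k = pbar + lift w" using M_iff by blast
    have "snd y $ k - c = w + b - (B w w / 2) *\<^sub>R a k"
      using w(2) by (simp add: c_def lift_def)
    then show "B (snd y $ k - c) (snd y $ k - c) = 0"
      using w(1) orth0[OF b_in w(1)] sym[of w b] a_b sym[of b "a k"]
      by (simp add: B.add_left B.add_right B.diff_left B.diff_right B.scaleR_left B.scaleR_right
          a_null b_null B_a_fibre)
  qed
  moreover have "snd z $ k - c = v + b - (B v v / 2) *\<^sub>R a k"
    using v(2) by (simp add: c_def lift_def)
  ultimately have "t = - B v p"
    using v(1) p orth0[OF b_in p(1)] a_b sym[of b "a k"]
    by (simp add: B.add_left B.add_right B.diff_left B.diff_right B.scaleR_left B.scaleR_right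
          a_null B_a_fibre)
  then show ?thesis using that fst p by simp
qed

text \<open>The base velocities pair with the \<open>a k\<close>-part of \<open>lift v\<close> in
  two equal terms, which together cancel the term from the square of \<open>lift v\<close>. The
  mixed terms of base and fibre velocities cancel likewise.\<close>

lemma metric_\<psi>:
  assumes z: "z \<in> M" and u: "u \<in> tangent_space M z" and u': "u' \<in> tangent_space M z"
  shows "B (warped_deriv B a c pbar z u) (warped_deriv B a c pbar z u') = wmetric c z u u'"
proof -
  obtain v where v: "v \<in> V k" "snd z $ k = pbar + lift v"
    using z M_iff by blast
  obtain p where p: "fst u \<in> V0" "p \<in> V k" "snd u $ k = p - B v p *\<^sub>R a k"
    using tangent_M[OF u v] by blast
  obtain p' where p': "fst u' \<in> V0" "p' \<in> V k" "snd u' $ k = p' - B v p' *\<^sub>R a k"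
    using tangent_M[OF u' v] by blast
  have 0: "B (fst u) v = 0" "B (fst u) p' = 0" "B v (fst u') = 0" "B p (fst u') = 0"
    using orth0 p(1,2) p'(1,2) v(1) sym by metis+
  have 1: "B (fst u) (a k) = B (a k) (fst u)" "B p v = B v p" by (rule sym)+
  show ?thesis
    by (simp add: warped_deriv_def warped_metric_def warp_def univ v(2) p(3) p'(3) lift_def
        B.add_left B.add_right B.diff_left B.diff_right B.scaleR_left B.scaleR_right
        a_null B_a_fibre[OF v(1)] B_a_fibre[OF p(2)] B_a_fibre[OF p'(2)] 0 1)
      (simp add: algebra_simps power2_eq_square)
qed

lemma image_eq: "{c + p | p. B (a k) p > 0} = Y"
  by (auto intro: exI[of _ "_ - c"])

lemma isometry: "isometry_onto M (wmetric c) Y (\<lambda>_. B) \<psi>"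
  by (rule isometry_warped_map[OF open_Y Ck_on_unwarp unwarp_\<psi> \<psi>_unwarp metric_\<psi>])

lemma \<psi>_image: "\<psi> ` M = Y"
  using unwarp_\<psi> \<psi>_unwarp by (force simp: image_iff)

text \<open>A closed half-space contains \<open>Y\<close>, and \<open>c - b\<close> lies outside it
  with value \<open>-1\<close>.\<close>

lemma not_dense: "closure Y \<noteq> UNIV"
proof -
  have "closed {y. 0 \<le> B (a k) (y - c)}"
    by (intro closed_Collect_le continuous_intros B.continuous_on)
  then have "closure Y \<subseteq> {y. 0 \<le> B (a k) (y - c)}"
    by (intro closure_minimal) auto
  moreover have "c - b \<notin> {y. 0 \<le> B (a k) (y - c)}"
    using a_b by (simp add: B.minus_right)
  ultimately show ?thesis by blast
qed

end

theorem theorem10p6: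
  fixes B :: "'a::euclidean_space \<Rightarrow> 'a \<Rightarrow> real" and \<nu> :: nat
    and pbar :: 'a and V0 :: "'a set"
    and V :: "'k::{finite,linorder} \<Rightarrow> 'a set" and a :: "'k \<Rightarrow> 'a"
  assumes "pseudo_euclidean B \<nu>" and "DIM('a) \<ge> 2"
    and "orthogonal_decomposition B V0 V"
    and "V0 \<noteq> {0}" and "\<And>i. V i \<noteq> {0}"
    and "\<And>i. a i \<in> V0" and "\<And>i j. i \<noteq> j \<Longrightarrow> B (a i) (a j) = 0"
  shows
    "(nonnull_case B a \<longrightarrow>
       (let c = pbar - (\<Sum>i\<in>UNIV. (1 / B (a i) (a i)) *\<^sub>R a i);
            N0 = base_set B V0 a c;
            N = (\<lambda>i. spherical B pbar (V i) (a i));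
            \<rho> = warp B a c;
            W = (\<lambda>i. line_plus (a i) (V i));
            P = (\<lambda>i. orth_proj B (W i));
            \<psi> = warped_map \<rho> pbar
        in openin (top_of_set ((+) pbar ` V0)) N0 \<and>
           (\<forall>i. \<forall>p\<in>N0. 0 < \<rho> i p \<and> \<rho> i p = 1 + B (a i) (p - pbar)) \<and>
           isometry_onto (warped_carrier N0 N) (warped_metric (\<lambda>_. B) (\<lambda>_ _. B) \<rho>)
             {c + p | p. \<forall>i. sgn (B (P i p) (P i p)) = sgn (B (a i) (a i))} (\<lambda>_. B) \<psi> \<and>
           (closure (\<psi> ` warped_carrier N0 N) = UNIV \<longleftrightarrow> (\<forall>i. definite_on (W i) B))))
     \<and>
     (\<forall>i b. CARD('k) = 1 \<and> lightlike B (a i) \<and> b \<in> V0 \<and> lightlike B b \<and> B (a i) b = 1 \<longrightarrow>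
       (let c = pbar - b;
            N0 = base_set B V0 a c;
            N = (\<lambda>i. spherical B pbar (V i) (a i));
            \<rho> = warp B a c;
            \<psi> = warped_map \<rho> pbar
        in openin (top_of_set ((+) pbar ` V0)) N0 \<and>
           (\<forall>i. \<forall>p\<in>N0. 0 < \<rho> i p \<and> \<rho> i p = 1 + B (a i) (p - pbar)) \<and>
           isometry_onto (warped_carrier N0 N) (warped_metric (\<lambda>_. B) (\<lambda>_ _. B) \<rho>)
             {c + p | p. B (a i) p > 0} (\<lambda>_. B) \<psi> \<and>
           closure (\<psi> ` warped_carrier N0 N) \<noteq> UNIV))"
proof (rule conjI; intro impI allI)
  have space: "decomposed_space B \<nu> V0 V a"
    using assms by unfold_locales (simp_all add: pseudo_euclidean_def)
  {
    assume "nonnull_case B a"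
    \<comment> \<open>The position of \<open>i\<close> is either at most \<open>\<mu>\<close> or
      beyond it, and each alternative gives a strict sign.\<close>
    then have "B (a i) (a i) \<noteq> 0" for i
      unfolding nonnull_case_def by (metis less_irrefl linorder_not_less)
    then interpret nonnull_decomposed_space B \<nu> V0 V a pbar
      using space by (simp add: nonnull_decomposed_space_def nonnull_decomposed_space_axioms_def)
    show "let c = pbar - (\<Sum>i\<in>UNIV. (1 / B (a i) (a i)) *\<^sub>R a i);
            N0 = base_set B V0 a c;
            N = (\<lambda>i. spherical B pbar (V i) (a i));
            \<rho> = warp B a c;
            W = (\<lambda>i. line_plus (a i) (V i));
            P = (\<lambda>i. orth_proj B (W i));
            \<psi> = warped_map \<rho> pbar
        in openin (top_of_set ((+) pbar ` V0)) N0 \<and>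
           (\<forall>i. \<forall>p\<in>N0. 0 < \<rho> i p \<and> \<rho> i p = 1 + B (a i) (p - pbar)) \<and>
           isometry_onto (warped_carrier N0 N) (warped_metric (\<lambda>_. B) (\<lambda>_ _. B) \<rho>)
             {c + p | p. \<forall>i. sgn (B (P i p) (P i p)) = sgn (B (a i) (a i))} (\<lambda>_. B) \<psi> \<and>
           (closure (\<psi> ` warped_carrier N0 N) = UNIV \<longleftrightarrow> (\<forall>i. definite_on (W i) B))"
      \<comment> \<open>Both the target set and the image of \<open>\<psi>\<close> become
        \<open>Y\<close>, so density is a statement about the closure of \<open>Y\<close>.\<close>
      unfolding Let_def c_def[symmetric] image_eq \<psi>_image
      using openin_base_set[OF pbar_c(1)] warp_pos warp_eq[OF pbar_c(2)] isometry
        dense_if_definite definite_if_dense by blast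
  next
    fix k b
    assume *: "CARD('k) = 1 \<and> lightlike B (a k) \<and> b \<in> V0 \<and> lightlike B b \<and> B (a k) b = 1"
    then have "UNIV = {k}" by (metis UNIV_I card_1_singletonE singletonD)
    then interpret null_decomposed_space B \<nu> V0 V a pbar k b
      using space * by (simp add: null_decomposed_space_def null_decomposed_space_axioms_def lightlike_def)
    \<comment> \<open>The normalisation by \<open>b\<close> is known for \<open>k\<close>, which is
      the only index.\<close>
    have warp: "\<forall>i. \<forall>p\<in>base_set B V0 a c. 0 < warp B a c i p \<and> warp B a c i p = 1 + B (a i) (p - pbar)"
      unfolding all_k using warp_pos warp_eq[OF pbar_c(2)] by blast
    show "let c = pbar - b;
            N0 = base_set B V0 a c;
            N = (\<lambda>i. spherical B pbar (V i) (a i));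
            \<rho> = warp B a c;
            \<psi> = warped_map \<rho> pbar
        in openin (top_of_set ((+) pbar ` V0)) N0 \<and>
           (\<forall>i. \<forall>p\<in>N0. 0 < \<rho> i p \<and> \<rho> i p = 1 + B (a i) (p - pbar)) \<and>
           isometry_onto (warped_carrier N0 N) (warped_metric (\<lambda>_. B) (\<lambda>_ _. B) \<rho>)
             {c + p | p. B (a k) p > 0} (\<lambda>_. B) \<psi> \<and>
           closure (\<psi> ` warped_carrier N0 N) \<noteq> UNIV"
      unfolding Let_def c_def[symmetric] image_eq \<psi>_image
      using openin_base_set[OF pbar_c(1)] warp isometry not_dense by blast
  }
qed

end
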